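(* Let $\eta,\theta\in\mathbb{R}$ with $1+\eta\theta\ge 0$, and let $(X_t)_{t\ge 0}$ be the Markov process with $X_0=0$ and transition probabilities $P_{s,t}(x,dy)$, $0\le s<t$ (defined in the context from $\eta,\theta$). For $0\le s<u$ let $\mathcal{G}_{s,u}=\sigma\{X_r: r\in[0,s]\cup[u,\infty)\}$. Then: (i) for all $s,t\ge 0$, $E(X_t)=0$ and $E(X_tX_s)=\min\{t,s\}$; (ii) for all $0\le s<t<u$, $$E(X_t\mid\mathcal{G}_{s,u})=\frac{u-t}{u-s}X_s+\frac{t-s}{u-s}X_u;$$ (iii) for all $0\le s<t<u$, $$\mathrm{Var}(X_t\mid\mathcal{G}_{s,u})=\frac{(u-t)(t-s)}{u}\left(1+\eta\,\frac{uX_s-sX_u}{u-s}+\theta\,\frac{X_u-X_s}{u-s}+\frac{(X_u-X_s)(sX_u-uX_s)}{(u-s)^2}\right).$$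
   Context: Conditional variance: $\mathrm{Var}(X\mid\mathcal{F})=E(X^2\mid\mathcal{F})-(E(X\mid\mathcal{F}))^2$. Fix $\eta,\theta\in\mathbb{R}$ with $1+\eta\theta\ge0$. For $0\le s<t$ and $x\in\mathbb{R}$, define monic polynomials $Q_n(y;x,t,s)$ in the variable $y$ by $Q_0(y;x,t,s)=1$, $Q_1(y;x,t,s)=y-x$, $$yQ_1(y;x,t,s)=Q_2(y;x,t,s)+((t-s)\eta+\theta)Q_1(y;x,t,s)+(t-s)(1+x\eta)Q_0(y;x,t,s),$$ and for $n\ge 2$ $$yQ_n(y;x,t,s)=Q_{n+1}(y;x,t,s)+(t\eta+\theta)Q_n(y;x,t,s)+t(1+\eta\theta)Q_{n-1}(y;x,t,s).$$ For $x$ in $E=\{x\in\mathbb{R}:1+\eta x\ge 0\}$, $P_{s,t}(x,dy)$ is the unique probability measure on $\mathbb{R}$ making the polynomials $\{Q_n(\cdot;x,t,s):n\ge0\}$ orthogonal, i.e. $\int Q_m(y;x,t,s)Q_n(y;x,t,s)\,P_{s,t}(x,dy)=0$ for $m\ne n$ (some $Q_n$ may have norm zero); it has bounded support. These kernels are regarded as transition probabilities on the state space $E$. *)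

theory Defs
  imports "HOL-Probability.Probability" "HOL-Computational_Algebra.Polynomial"
begin

text \<open>\<open>Q \<eta> \<theta> x t s n\<close> is \<open>Q\<^sub>n(y; x, t, s)\<close> as a polynomial in \<open>y\<close>; the factor
  \<open>[:0, 1:]\<close> is the variable \<open>y\<close>. The step producing \<open>Q\<^sub>2\<close> has its own coefficients.\<close>

fun Q :: "real \<Rightarrow> real \<Rightarrow> real \<Rightarrow> real \<Rightarrow> real \<Rightarrow> nat \<Rightarrow> real poly" where
  "Q \<eta> \<theta> x t s 0 = 1"
| "Q \<eta> \<theta> x t s (Suc 0) = [:- x, 1:]"
| "Q \<eta> \<theta> x t s (Suc (Suc 0)) =
     [:0, 1:] * Q \<eta> \<theta> x t s (Suc 0)
     - smult ((t - s) * \<eta> + \<theta>) (Q \<eta> \<theta> x t s (Suc 0))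
     - smult ((t - s) * (1 + x * \<eta>)) (Q \<eta> \<theta> x t s 0)"
| "Q \<eta> \<theta> x t s (Suc (Suc (Suc n))) =
     [:0, 1:] * Q \<eta> \<theta> x t s (Suc (Suc n))
     - smult (t * \<eta> + \<theta>) (Q \<eta> \<theta> x t s (Suc (Suc n)))
     - smult (t * (1 + \<eta> * \<theta>)) (Q \<eta> \<theta> x t s (Suc n))"

definition state_space :: "real \<Rightarrow> real set" where
  "state_space \<eta> = {x. 1 + \<eta> * x \<ge> 0}"

text \<open>The integrability clause rules out measures for which an orthogonality relation would hold
  only because the Bochner integral of a non-integrable function is 0. The case \<open>m = n\<close> is not
  constrained further: some \<open>Q\<^sub>n\<close> may have norm zero.\<close>

definition orthogonality_measure ::
  "real \<Rightarrow> real \<Rightarrow> real \<Rightarrow> real \<Rightarrow> real \<Rightarrow> real measure \<Rightarrow> bool" where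
  "orthogonality_measure \<eta> \<theta> s t x \<mu> \<longleftrightarrow>
     prob_space \<mu> \<and> sets \<mu> = sets borel \<and>
     (\<forall>m n. integrable \<mu> (\<lambda>y. poly (Q \<eta> \<theta> x t s m) y * poly (Q \<eta> \<theta> x t s n) y)) \<and>
     (\<forall>m n. m \<noteq> n \<longrightarrow>
        (\<integral>y. poly (Q \<eta> \<theta> x t s m) y * poly (Q \<eta> \<theta> x t s n) y \<partial>\<mu>) = 0)"

text \<open>For each \<open>0 \<le> s < t\<close> and \<open>x\<close> in the state space there is exactly one orthogonality
  measure, so this predicate determines \<open>P s t x\<close> there; all other values are irrelevant.\<close>

definition transition_kernels ::
  "real \<Rightarrow> real \<Rightarrow> (real \<Rightarrow> real \<Rightarrow> real \<Rightarrow> real measure) \<Rightarrow> bool" where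
  "transition_kernels \<eta> \<theta> P \<longleftrightarrow>
     (\<forall>s t x. 0 \<le> s \<longrightarrow> s < t \<longrightarrow> x \<in> state_space \<eta> \<longrightarrow>
        orthogonality_measure \<eta> \<theta> s t x (P s t x))"

definition sigma_gen :: "'a measure \<Rightarrow> (real \<Rightarrow> 'a \<Rightarrow> real) \<Rightarrow> real set \<Rightarrow> 'a measure" where
  "sigma_gen M X T = sigma (space M) {X r -` A \<inter> space M | r A. r \<in> T \<and> A \<in> sets borel}"

text \<open>Markov property with respect to the natural filtration; only times \<open>t \<ge> 0\<close> matter.\<close>

definition markov_process ::
  "'a measure \<Rightarrow> real set \<Rightarrow> (real \<Rightarrow> real \<Rightarrow> real \<Rightarrow> real measure) \<Rightarrow>
     (real \<Rightarrow> 'a \<Rightarrow> real) \<Rightarrow> bool" where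
  "markov_process M E P X \<longleftrightarrow>
     (\<forall>t\<ge>0. X t \<in> measurable M (restrict_space borel E)) \<and>
     (\<forall>s t A. 0 \<le> s \<longrightarrow> s < t \<longrightarrow> A \<in> sets borel \<longrightarrow>
        (AE \<omega> in M. real_cond_exp M (sigma_gen M X {0..s}) (\<lambda>\<omega>. indicator A (X t \<omega>)) \<omega>
                     = measure (P s t (X s \<omega>)) A))"

definition cond_variance :: "'a measure \<Rightarrow> 'a measure \<Rightarrow> ('a \<Rightarrow> real) \<Rightarrow> 'a \<Rightarrow> real" where
  "cond_variance M F Y \<omega> =
     real_cond_exp M F (\<lambda>\<omega>. (Y \<omega>)\<^sup>2) \<omega> - (real_cond_exp M F Y \<omega>)\<^sup>2"

end

theory Submission
  imports Defs
begin

text \<open>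
  Besides the orthogonal polynomials \<open>Q\<^sub>n(y; x, t, s)\<close>, which depend on a starting point, there is one
  family \<open>p\<^sub>n(y; t)\<close> (\<open>mart_poly\<close>) that every kernel transports correctly:
  \<open>\<integral> p\<^sub>n(y; t) P\<^sub>s\<^sub>,\<^sub>t(x, dy) = p\<^sub>n(x; s)\<close>. It is found by computing the generating function
  of the \<open>Q\<^sub>n\<close>: with \<open>D\<^sub>t(y) = (1 + t\<eta>z)(1 + \<theta>z) + tz\<^sup>2 - yz\<close> one gets
  \<open>\<Sum>\<^sub>n Q\<^sub>n(y; x, t, s) z\<^sup>n = - s\<eta>z + (1 + t\<eta>z) D\<^sub>s(x) / D\<^sub>t(y)\<close>. As all \<open>Q\<^sub>n\<close> with \<open>n > 0\<close> have mean
  zero, \<open>(1 + t\<eta>z) / D\<^sub>t(y)\<close> is a martingale, and the \<open>p\<^sub>n\<close> are its coefficients.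

  They satisfy \<open>y p\<^sub>n = ((A + tG) p)\<^sub>n\<close> for two operators \<open>A\<close>, \<open>G\<close> on sequences that do not depend on
  the time. Hence, when \<open>s \<le> r \<le> r' \<le> u\<close> and \<open>Z\<close> depends on the process up to time \<open>s\<close>, putting
  \<open>\<alpha>\<^sub>n = E(Z p\<^sub>n(X\<^sub>s; s))\<close> gives \<open>E(Z X\<^sub>r p\<^sub>n(X\<^sub>u; u)) = ((A + rG) \<alpha>)\<^sub>n\<close> and
  \<open>E(Z X\<^sub>r X\<^sub>r' p\<^sub>n(X\<^sub>u; u)) = ((A + r'G)(A + rG) \<alpha>)\<^sub>n\<close>. The first expression is affine in \<open>r\<close>, which
  is the formula for the conditional mean. In the second one the relation \<open>AG = 1 + \<eta>A + \<theta>G\<close>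
  rewrites \<open>(A + tG)\<^sup>2\<close> in terms of the times \<open>s\<close> and \<open>u\<close>, and this is the formula
  for the conditional second moment (lemma \<open>jacobi_quadratic\<close>).

  It remains to see that testing against such \<open>Z\<close> and polynomials in \<open>X\<^sub>u\<close> determines a conditional
  expectation given \<open>\<G>\<^sub>s\<^sub>,\<^sub>u\<close> (lemma \<open>cond_exp_eqI\<close>). The three-term recursion bounds the
  moments of \<open>X\<^sub>t\<close> geometrically, so every \<open>X\<^sub>t\<close> is essentially bounded, and on bounded variables
  the joint moments determine all integrals over the generated \<open>\<sigma>\<close>-algebra. The kernels map
  polynomials to polynomials; therefore a monomial in finitely many variables after time \<open>u\<close>
  can be replaced by a polynomial in \<open>X\<^sub>u\<close> alone.
\<close>

section \<open>Martingale polynomials of the kernels\<close>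

text \<open>The coefficients of the power series \<open>(1 + t\<eta>z) / ((1 + t\<eta>z)(1 + \<theta>z) + tz\<^sup>2 - yz)\<close> in \<open>z\<close>. The
  first step differs from the later ones because of the numerator.\<close>

fun mart_poly :: "real \<Rightarrow> real \<Rightarrow> real \<Rightarrow> nat \<Rightarrow> real poly" where
  "mart_poly \<eta> \<theta> t 0 = 1"
| "mart_poly \<eta> \<theta> t (Suc 0) = [:- \<theta>, 1:]"
| "mart_poly \<eta> \<theta> t (Suc (Suc n)) =
     [:- \<theta>, 1:] * mart_poly \<eta> \<theta> t (Suc n)
     - smult t (smult \<eta> (mart_poly \<eta> \<theta> t (Suc n)) + smult (1 + \<eta> * \<theta>) (mart_poly \<eta> \<theta> t n))"

text \<open>One shape for the recursions of both polynomial families. The number \<open>R\<close> bounds multiplication by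
  \<open>y\<close> in the \<open>\<ell>\<^sub>1\<close>-norm of coefficients with respect to the family; the index \<open>m\<close> is \<open>n - 1\<close> in
  the applications, and arbitrary when \<open>n = 0\<close>.\<close>

definition three_term :: "real \<Rightarrow> (nat \<Rightarrow> real poly) \<Rightarrow> bool" where
  "three_term R q \<longleftrightarrow> q 0 = 1 \<and>
     (\<forall>n. \<exists>a b m. 1 + \<bar>a\<bar> + \<bar>b\<bar> \<le> R \<and>
        [:0, 1:] * q n = q (Suc n) + smult a (q n) + smult b (q m))"

lemma three_term_mart_poly:
  "three_term (1 + (\<bar>\<theta>\<bar> + \<bar>\<theta> + t * \<eta>\<bar>) + \<bar>t * (1 + \<eta> * \<theta>)\<bar>) (mart_poly \<eta> \<theta> t)"
  unfolding three_term_def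
proof (intro conjI allI)
  show "mart_poly \<eta> \<theta> t 0 = 1" by simp
  fix n
  show "\<exists>a b m. 1 + \<bar>a\<bar> + \<bar>b\<bar> \<le> 1 + (\<bar>\<theta>\<bar> + \<bar>\<theta> + t * \<eta>\<bar>) + \<bar>t * (1 + \<eta> * \<theta>)\<bar> \<and>
     [:0, 1:] * mart_poly \<eta> \<theta> t n =
       mart_poly \<eta> \<theta> t (Suc n) + smult a (mart_poly \<eta> \<theta> t n) + smult b (mart_poly \<eta> \<theta> t m)"
  proof (cases n)
    case 0
    show ?thesis
      by (rule exI[of _ \<theta>], rule exI[of _ 0], rule exI[of _ 0]) (simp add: 0)
  next
    case (Suc k)
    show ?thesis
      by (rule exI[of _ "\<theta> + t * \<eta>"], rule exI[of _ "t * (1 + \<eta> * \<theta>)"], rule exI[of _ k])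
        (simp add: Suc poly_eq_poly_eq_iff[symmetric] fun_eq_iff algebra_simps)
  qed
qed

lemma three_term_Q:
  "three_term (1 + (\<bar>x\<bar> + \<bar>(t - s) * \<eta> + \<theta>\<bar> + \<bar>t * \<eta> + \<theta>\<bar>)
      + (\<bar>(t - s) * (1 + x * \<eta>)\<bar> + \<bar>t * (1 + \<eta> * \<theta>)\<bar>)) (Q \<eta> \<theta> x t s)"
  unfolding three_term_def
proof (intro conjI allI)
  show "Q \<eta> \<theta> x t s 0 = 1" by simp
  fix n
  consider "n = 0" | "n = 1" | k where "n = Suc (Suc k)"
    by (metis One_nat_def not0_implies_Suc)
  then show "\<exists>a b m. 1 + \<bar>a\<bar> + \<bar>b\<bar> \<le> 1 + (\<bar>x\<bar> + \<bar>(t - s) * \<eta> + \<theta>\<bar> + \<bar>t * \<eta> + \<theta>\<bar>)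
      + (\<bar>(t - s) * (1 + x * \<eta>)\<bar> + \<bar>t * (1 + \<eta> * \<theta>)\<bar>) \<and>
     [:0, 1:] * Q \<eta> \<theta> x t s n =
       Q \<eta> \<theta> x t s (Suc n) + smult a (Q \<eta> \<theta> x t s n) + smult b (Q \<eta> \<theta> x t s m)"
  proof cases
    case 1
    show ?thesis
      by (rule exI[of _ x], rule exI[of _ 0], rule exI[of _ 0]) (simp add: 1)
  next
    case 2
    show ?thesis
      by (rule exI[of _ "(t - s) * \<eta> + \<theta>"], rule exI[of _ "(t - s) * (1 + x * \<eta>)"],
          rule exI[of _ 0])
        (simp add: 2 poly_eq_poly_eq_iff[symmetric] fun_eq_iff algebra_simps)
  next
    case 3
    show ?thesis
      by (rule exI[of _ "t * \<eta> + \<theta>"], rule exI[of _ "t * (1 + \<eta> * \<theta>)"], rule exI[of _ "Suc k"])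
        (simp add: 3 poly_eq_poly_eq_iff[symmetric] fun_eq_iff algebra_simps)
  qed
qed

text \<open>Such a family spans all polynomials: the recursion keeps its span closed under multiplication
  by \<open>y\<close>. Stated as an induction principle for linear properties.\<close>

lemma three_term_span:
  assumes q: "three_term R q"
    and base: "\<And>n. S (q n)"
    and add: "\<And>f g. S f \<Longrightarrow> S g \<Longrightarrow> S (f + g)"
    and smult: "\<And>c f. S f \<Longrightarrow> S (smult c f)"
  shows "S f"
proof -
  have monom_q: "S ([:0, 1:] ^ k * q n)" for k n
  proof (induction k arbitrary: n)
    case (Suc k)
    obtain a b m where rec: "[:0, 1:] * q n = q (Suc n) + smult a (q n) + smult b (q m)"
      using q unfolding three_term_def by blast
    have "[:0, 1:] ^ Suc k * q n = [:0, 1:] ^ k * ([:0, 1:] * q n)"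
      by (metis mult.assoc power_Suc2)
    also have "\<dots> = [:0, 1:] ^ k * q (Suc n) + smult a ([:0, 1:] ^ k * q n)
        + smult b ([:0, 1:] ^ k * q m)"
      unfolding rec by (simp only: distrib_left mult_smult_right)
    finally show ?case
      using add smult Suc.IH by presburger
  qed (simp add: base)
  have "S ([:0, 1:] ^ k * f)" for k
  proof (induction f arbitrary: k)
    case 0
    show ?case using smult[OF base, of 0] by simp
  next
    case (pCons a f)
    have "[:0, 1:] ^ k * pCons a f = smult a ([:0, 1:] ^ k * q 0) + [:0, 1:] ^ Suc k * f"
      using q unfolding three_term_def
      by (simp add: poly_eq_poly_eq_iff[symmetric] fun_eq_iff algebra_simps)
    then show ?case using add smult monom_q pCons.IH by presburger
  qed
  from this[of 0] show ?thesis by simp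
qed

text \<open>Applying the recursion \<open>k\<close> times bounds the \<open>k\<close>-th moment by \<open>R\<^sup>k\<close>, and a measure with
  such moments has no mass beyond \<open>R\<close>; the margin \<open>1\<close> in the conclusion lets Markov's inequality for the even moments
  converge to \<open>0\<close>.\<close>

lemma three_term_support:
  assumes q: "three_term R q" and \<mu>: "prob_space \<mu>" "sets \<mu> = sets borel"
    and int: "\<And>f. integrable \<mu> (poly f)"
    and orth: "\<And>n. \<bar>\<integral>y. poly (q n) y \<partial>\<mu>\<bar> \<le> 1"
  shows "AE y in \<mu>. \<bar>y\<bar> \<le> R + 1"
proof -
  interpret prob_space \<mu> by (rule \<mu>)
  have R: "1 \<le> R"
  proof -
    obtain a b where "1 + \<bar>a\<bar> + \<bar>b\<bar> \<le> R"
      using q unfolding three_term_def by blast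
    then show ?thesis by linarith
  qed
  have bound: "\<bar>\<integral>y. y ^ k * poly (q n) y \<partial>\<mu>\<bar> \<le> R ^ k" for k n
  proof (induction k arbitrary: n)
    case 0
    show ?case using orth by simp
  next
    case (Suc k)
    obtain a b m where ab: "1 + \<bar>a\<bar> + \<bar>b\<bar> \<le> R"
      and rec: "[:0, 1:] * q n = q (Suc n) + smult a (q n) + smult b (q m)"
      using q unfolding three_term_def by blast
    have i: "integrable \<mu> (\<lambda>y. y ^ k * poly (q j) y)" for j
      using int[of "[:0, 1:] ^ k * q j"]
      by (simp add: poly_mult[abs_def] poly_power[abs_def] del: poly_mult poly_power)
    have "y ^ Suc k * poly (q n) y =
        y ^ k * poly (q (Suc n)) y + a * (y ^ k * poly (q n) y) + b * (y ^ k * poly (q m) y)" for y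
      using arg_cong[OF rec, of "\<lambda>p. y ^ k * poly p y"] by (simp add: algebra_simps)
    then have "(\<integral>y. y ^ Suc k * poly (q n) y \<partial>\<mu>) =
        (\<integral>y. y ^ k * poly (q (Suc n)) y \<partial>\<mu>) + a * (\<integral>y. y ^ k * poly (q n) y \<partial>\<mu>)
        + b * (\<integral>y. y ^ k * poly (q m) y \<partial>\<mu>)"
      using i by simp
    also have "\<bar>\<dots>\<bar> \<le> R ^ k + \<bar>a\<bar> * R ^ k + \<bar>b\<bar> * R ^ k"
      by (intro abs_triangle_ineq[THEN order_trans] add_mono)
        (auto simp: abs_mult intro!: mult_left_mono Suc.IH)
    also have "\<dots> = (1 + \<bar>a\<bar> + \<bar>b\<bar>) * R ^ k" by (simp add: algebra_simps)
    also have "\<dots> \<le> R ^ Suc k" using ab R by (simp add: mult_right_mono)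
    finally show ?case .
  qed
  have "measure \<mu> {y\<in>space \<mu>. R + 1 < \<bar>y\<bar>} \<le> ((R / (R + 1))\<^sup>2) ^ k" for k
  proof -
    have int2: "integrable \<mu> (\<lambda>y. y ^ (2 * k))"
      using int[of "[:0, 1:] ^ (2 * k)"] by (simp add: poly_power[abs_def] del: poly_power)
    have "measure \<mu> {y\<in>space \<mu>. R + 1 < \<bar>y\<bar>} \<le> measure \<mu> {y\<in>space \<mu>. y ^ (2 * k) \<ge> (R + 1) ^ (2 * k)}"
    proof (rule finite_measure_mono)
      have "(R + 1) ^ (2 * k) \<le> \<bar>y\<bar> ^ (2 * k)" if "R + 1 < \<bar>y\<bar>" for y
        using that R by (intro power_mono) auto
      then show "{y\<in>space \<mu>. R + 1 < \<bar>y\<bar>} \<subseteq> {y\<in>space \<mu>. y ^ (2 * k) \<ge> (R + 1) ^ (2 * k)}"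
        by (auto simp: power_even_abs)
    qed (use \<mu>(2) in measurable)
    also have "\<dots> \<le> (\<integral>y. y ^ (2 * k) \<partial>\<mu>) / (R + 1) ^ (2 * k)"
      using R by (intro integral_Markov_inequality_measure[OF int2, where A = "{}"]) auto
    also have "\<dots> \<le> R ^ (2 * k) / (R + 1) ^ (2 * k)"
      using bound[of "2 * k" 0] q R unfolding three_term_def
      by (intro divide_right_mono) auto
    also have "\<dots> = ((R / (R + 1))\<^sup>2) ^ k"
      by (simp add: power_mult power_divide)
    finally show ?thesis .
  qed
  moreover have "(\<lambda>k. ((R / (R + 1))\<^sup>2) ^ k) \<longlonglongrightarrow> 0"
    using R by (intro LIMSEQ_realpow_zero) (auto simp: power_less_one_iff)
  ultimately have "measure \<mu> {y\<in>space \<mu>. R + 1 < \<bar>y\<bar>} \<le> 0"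
    by (intro LIMSEQ_le_const) auto
  then have "measure \<mu> {y\<in>space \<mu>. R + 1 < \<bar>y\<bar>} = 0"
    by (simp add: measure_le_0_iff)
  then have "AE y in \<mu>. \<not> R + 1 < \<bar>y\<bar>"
    using \<mu>(2) by (subst (asm) prob_Collect_eq_0) (auto simp: measurable_cong_sets)
  then show ?thesis by eventually_elim simp
qed

text \<open>Orthogonality to \<open>Q\<^sub>0 = 1\<close> says that the other \<open>Q\<^sub>n\<close> have mean zero, which already
  fixes every moment of the kernel.\<close>

lemma orthogonality_measure_moments:
  assumes "orthogonality_measure \<eta> \<theta> s t x \<mu>"
  shows "integrable \<mu> (poly f)"
    and "(\<integral>y. poly (Q \<eta> \<theta> x t s (Suc n)) y \<partial>\<mu>) = 0"
proof -
  have int: "integrable \<mu> (\<lambda>y. poly (Q \<eta> \<theta> x t s m) y * poly (Q \<eta> \<theta> x t s n) y)" for m n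
    using assms unfolding orthogonality_measure_def by blast
  show "integrable \<mu> (poly f)"
  proof (rule three_term_span[OF three_term_Q])
    show "integrable \<mu> (poly (Q \<eta> \<theta> x t s n))" for n
      using int[of 0 n] by simp
  qed (simp_all add: poly_add[abs_def] poly_smult[abs_def])
  show "(\<integral>y. poly (Q \<eta> \<theta> x t s (Suc n)) y \<partial>\<mu>) = 0"
    using assms unfolding orthogonality_measure_def
    by (metis (mono_tags, lifting) Bochner_Integration.integral_cong Q.simps(1) mult_1 nat.distinct(1) poly_1)
qed

text \<open>The coefficient of \<open>z\<^sup>n\<^sup>+\<^sup>2\<close> in the identity
  \<open>\<Sum>\<^sub>n Q\<^sub>n(y; x, t, s) z\<^sup>n = - s\<eta>z + D\<^sub>s(x) \<Sum>\<^sub>n p\<^sub>n(y; t) z\<^sup>n\<close>. The same numbers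
  are the coefficients of the recursion of \<open>p\<^sub>n(x; s)\<close>.\<close>

lemma Q_eq_mart_poly:
  "poly (Q \<eta> \<theta> x t s (Suc (Suc n))) y =
     poly (mart_poly \<eta> \<theta> t (Suc (Suc n))) y
     + (\<theta> - x + s * \<eta>) * poly (mart_poly \<eta> \<theta> t (Suc n)) y
     + s * (1 + \<eta> * \<theta>) * poly (mart_poly \<eta> \<theta> t n) y"
proof (induction n rule: induct_nat_012)
  case (ge2 n)
  have "poly (Q \<eta> \<theta> x t s (Suc (Suc (Suc (Suc n))))) y =
      y * poly (Q \<eta> \<theta> x t s (Suc (Suc (Suc n)))) y
      - (t * \<eta> + \<theta>) * poly (Q \<eta> \<theta> x t s (Suc (Suc (Suc n)))) y
      - t * (1 + \<eta> * \<theta>) * poly (Q \<eta> \<theta> x t s (Suc (Suc n))) y"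
    by (subst Q.simps(4)) (simp del: Q.simps)
  then show ?case
    unfolding ge2.IH by (simp add: algebra_simps)
qed (simp_all add: algebra_simps)

text \<open>Integrating the previous identity, the left side vanishes and what remains is the
  recursion that defines \<open>p\<^sub>n(x; s)\<close>.\<close>

lemma integral_mart_poly:
  assumes "orthogonality_measure \<eta> \<theta> s t x \<mu>"
  shows "(\<integral>y. poly (mart_poly \<eta> \<theta> t n) y \<partial>\<mu>) = poly (mart_poly \<eta> \<theta> s n) x"
proof -
  interpret prob_space \<mu> using assms unfolding orthogonality_measure_def by blast
  note int [simp] = orthogonality_measure_moments(1)[OF assms]
  note zero = orthogonality_measure_moments(2)[OF assms]
  show ?thesis
  proof (induction n rule: induct_nat_012)
    case 0
    show ?case by (simp add: prob_space)
  next
    case 1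
    have "(\<integral>y. poly (mart_poly \<eta> \<theta> t (Suc 0)) y \<partial>\<mu>)
        = (\<integral>y. poly (Q \<eta> \<theta> x t s (Suc 0)) y + (x - \<theta>) \<partial>\<mu>)"
      by simp
    also have "\<dots> = x - \<theta>"
      using zero[of 0] by (simp add: prob_space del: Q.simps)
    finally show ?case by simp
  next
    case (ge2 n)
    have "poly (mart_poly \<eta> \<theta> t (Suc (Suc n))) y = poly (Q \<eta> \<theta> x t s (Suc (Suc n))) y
        - (\<theta> - x + s * \<eta>) * poly (mart_poly \<eta> \<theta> t (Suc n)) y
        - s * (1 + \<eta> * \<theta>) * poly (mart_poly \<eta> \<theta> t n) y" for y
      unfolding Q_eq_mart_poly by simp
    then have "(\<integral>y. poly (mart_poly \<eta> \<theta> t (Suc (Suc n))) y \<partial>\<mu>)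
        = - ((\<theta> - x + s * \<eta>) * poly (mart_poly \<eta> \<theta> s (Suc n)) x)
        - s * (1 + \<eta> * \<theta>) * poly (mart_poly \<eta> \<theta> s n) x"
      using zero[of "Suc n"] ge2 by (simp del: Q.simps mart_poly.simps)
    then show ?case by (simp add: algebra_simps)
  qed
qed

section \<open>The recursion as an operator on sequences\<close>

text \<open>The operator \<open>A + tG\<close> on sequences: \<open>A\<close> is the shift plus \<open>\<theta>\<close>, and \<open>G\<close> is the bracket
  multiplied by \<open>t\<close>. On \<open>\<lambda>n. p\<^sub>n(y; t)\<close> it acts as multiplication by \<open>y\<close>. Keeping \<open>G\<close>
  equal to \<open>0\<close> at index \<open>0\<close> makes the same formula cover the exceptional first step of the recursion.\<close>

definition jacobi :: "real \<Rightarrow> real \<Rightarrow> real \<Rightarrow> (nat \<Rightarrow> real) \<Rightarrow> nat \<Rightarrow> real" where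
  "jacobi \<eta> \<theta> t a n =
     a (Suc n) + \<theta> * a n
     + t * (case n of 0 \<Rightarrow> 0 | Suc k \<Rightarrow> \<eta> * a (Suc k) + (1 + \<eta> * \<theta>) * a k)"

lemma poly_mart_poly_jacobi:
  "y * poly (mart_poly \<eta> \<theta> t n) y = jacobi \<eta> \<theta> t (\<lambda>k. poly (mart_poly \<eta> \<theta> t k) y) n"
  by (cases n) (simp_all add: jacobi_def algebra_simps)

lemma jacobi_affine:
  obtains A G where "\<And>r. jacobi \<eta> \<theta> r a n = A + r * G"
  unfolding jacobi_def by blast

text \<open>Affine functions of \<open>t\<close> are interpolated linearly from \<open>s\<close> and \<open>u\<close>.\<close>

lemma jacobi_interpolation:
  fixes s t u :: real
  assumes "s < u"
  shows "jacobi \<eta> \<theta> t a n =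
    (u - t) / (u - s) * jacobi \<eta> \<theta> s a n + (t - s) / (u - s) * jacobi \<eta> \<theta> u a n"
proof -
  obtain A G where "\<And>r. jacobi \<eta> \<theta> r a n = A + r * G"
    using that by (rule jacobi_affine[of \<eta> \<theta> a n])
  then show ?thesis using assms by (simp add: divide_simps) (simp add: algebra_simps)
qed

text \<open>In the expansion of \<open>(A + r'G)(A + rG)\<close> the coefficient of \<open>r\<close> is \<open>AG\<close>, and
  \<open>AG = 1 + \<eta>A + \<theta>G\<close>. This relation holds at every index, while for \<open>GA\<close> it fails at index
  \<open>0\<close>; so the order of the two factors matters, and \<open>GA\<close> and \<open>G\<^sup>2\<close> stay unspecified.\<close>

lemma jacobi_commutation:
  obtains A G AA GA GG where "\<And>r. jacobi \<eta> \<theta> r a n = A + r * G"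
    and "\<And>r r'. jacobi \<eta> \<theta> r' (jacobi \<eta> \<theta> r a) n
      = AA + r * (a n + \<eta> * A + \<theta> * G) + r' * GA + r * r' * GG"
proof (cases n)
  case 0
  show thesis
    by (rule that[of "a 1 + \<theta> * a 0" 0 "a 2 + \<theta> * a 1 + \<theta> * (a 1 + \<theta> * a 0)" 0 0])
      (simp_all add: 0 jacobi_def numeral_2_eq_2 algebra_simps)
next
  case (Suc k)
  define g where "g = (case k of 0 \<Rightarrow> 0 | Suc k \<Rightarrow> \<eta> * a (Suc k) + (1 + \<eta> * \<theta>) * a k)"
  show thesis
    by (rule that[of "a (Suc n) + \<theta> * a n" "\<eta> * a n + (1 + \<eta> * \<theta>) * a k"
          "a (Suc (Suc n)) + \<theta> * a (Suc n) + \<theta> * (a (Suc n) + \<theta> * a n)"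
          "\<eta> * (a (Suc n) + \<theta> * a n) + (1 + \<eta> * \<theta>) * (a n + \<theta> * a k)"
          "\<eta> * (\<eta> * a n + (1 + \<eta> * \<theta>) * a k) + (1 + \<eta> * \<theta>) * g"])
      (simp_all add: Suc jacobi_def g_def[symmetric] algebra_simps)
qed

text \<open>Matching the coefficients of \<open>A\<^sup>2\<close>, \<open>GA\<close> and \<open>G\<^sup>2\<close> in
  \<open>(A + tG)\<^sup>2 = x(A + sG)\<^sup>2 + y(A + uG)(A + sG) + z(A + uG)\<^sup>2 + \<dots>\<close> leaves a multiple \<open>\<kappa>\<close> of \<open>AG\<close>,
  which is \<open>\<kappa>(1 + \<eta>A + \<theta>G)\<close> and is written by means of \<open>A + sG\<close>, \<open>A + uG\<close> and \<open>1\<close>. The value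
  of \<open>\<kappa>\<close> is forced by these equations; it is the factor in front of the conditional variance.\<close>

lemma jacobi_quadratic:
  fixes s t u :: real
  assumes "0 \<le> s" "s < u"
    and \<kappa>: "\<kappa> = (u - t) * (t - s) / u"
  shows "jacobi \<eta> \<theta> t (jacobi \<eta> \<theta> t a) n =
    (u - t) / (u - s) * jacobi \<eta> \<theta> s (jacobi \<eta> \<theta> s a) n
    + (2 * (u - t) * (t - s) - \<kappa> * (s + u)) / (u - s)\<^sup>2 * jacobi \<eta> \<theta> u (jacobi \<eta> \<theta> s a) n
    + ((t - s)\<^sup>2 + \<kappa> * s) / (u - s)\<^sup>2 * jacobi \<eta> \<theta> u (jacobi \<eta> \<theta> u a) n
    + \<kappa> * (\<eta> * u - \<theta>) / (u - s) * jacobi \<eta> \<theta> s a n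
    + \<kappa> * (\<theta> - \<eta> * s) / (u - s) * jacobi \<eta> \<theta> u a n
    + \<kappa> * a n"
proof -
  obtain A G AA GA GG where 1: "\<And>r. jacobi \<eta> \<theta> r a n = A + r * G"
    and 2: "\<And>r r'. jacobi \<eta> \<theta> r' (jacobi \<eta> \<theta> r a) n
      = AA + r * (a n + \<eta> * A + \<theta> * G) + r' * GA + r * r' * GG"
    using jacobi_commutation by blast
  define x where "x = (u - t) / (u - s)"
  define y where "y = (2 * (u - t) * (t - s) - \<kappa> * (s + u)) / (u - s)\<^sup>2"
  define z where "z = ((t - s)\<^sup>2 + \<kappa> * s) / (u - s)\<^sup>2"
  define d where "d = \<kappa> * (\<eta> * u - \<theta>) / (u - s)"
  define e where "e = \<kappa> * (\<theta> - \<eta> * s) / (u - s)"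
  have w: "u - s \<noteq> 0" "u \<noteq> 0" using assms by auto
  have xw: "x * (u - s) = u - t" and yw: "y * (u - s)\<^sup>2 = 2 * (u - t) * (t - s) - \<kappa> * (s + u)"
    and zw: "z * (u - s)\<^sup>2 = (t - s)\<^sup>2 + \<kappa> * s" and dw: "d * (u - s) = \<kappa> * (\<eta> * u - \<theta>)"
    and ew: "e * (u - s) = \<kappa> * (\<theta> - \<eta> * s)" and \<kappa>u: "\<kappa> * u = (u - t) * (t - s)"
    using w unfolding x_def y_def z_def d_def e_def \<kappa> by simp_all
  have cancel: "l = r" if "(l - r) * (u - s)\<^sup>2 = 0" for l r
    using that w by simp
  \<comment> \<open>coefficients of \<open>A\<^sup>2\<close>, \<open>AG\<close>, \<open>GA\<close>, \<open>G\<^sup>2\<close>, and of \<open>A\<close>, \<open>G\<close> in the remainder \<open>\<kappa>(1 + \<eta>A + \<theta>G)\<close>\<close>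
  have c0: "x + y + z = 1"
    by (rule cancel) (use xw yw zw \<kappa>u in algebra)
  have c1: "x * s + y * s + z * u = t - \<kappa>"
    by (rule cancel) (use xw yw zw \<kappa>u in algebra)
  have c2: "x * s + y * u + z * u = t"
    by (rule cancel) (use xw yw zw \<kappa>u in algebra)
  have c3: "x * s * s + y * s * u + z * u * u = t * t"
    by (rule cancel) (use xw yw zw \<kappa>u in algebra)
  have c4: "d + e = \<kappa> * \<eta>"
    by (rule cancel) (use dw ew in algebra)
  have c5: "d * s + e * u = \<kappa> * \<theta>"
    by (rule cancel) (use dw ew in algebra)
  show ?thesis
    unfolding 1 2 x_def[symmetric] y_def[symmetric] z_def[symmetric] d_def[symmetric] e_def[symmetric]
    using c0 c1 c2 c3 c4 c5 by algebra
qed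

text \<open>The second moment of \<open>jacobi_quadratic\<close> minus the square of the interpolated mean, for \<open>x\<close> and
  \<open>y\<close> the values at the times \<open>s\<close> and \<open>u\<close>.\<close>

lemma harness_variance_expand:
  fixes s t u x y :: real
  assumes "0 \<le> s" "s < u" and \<kappa>: "\<kappa> = (u - t) * (t - s) / u"
  shows "(u - t) / (u - s) * (x * x)
      + (2 * (u - t) * (t - s) - \<kappa> * (s + u)) / (u - s)\<^sup>2 * (x * y)
      + ((t - s)\<^sup>2 + \<kappa> * s) / (u - s)\<^sup>2 * (y * y)
      + \<kappa> * (\<eta> * u - \<theta>) / (u - s) * x + \<kappa> * (\<theta> - \<eta> * s) / (u - s) * y + \<kappa>
      - ((u - t) / (u - s) * x + (t - s) / (u - s) * y)\<^sup>2
    = \<kappa> * (1 + \<eta> * ((u * x - s * y) / (u - s)) + \<theta> * ((y - x) / (u - s))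
        + (y - x) * (s * y - u * x) / (u - s)\<^sup>2)"
proof -
  have w: "u - s \<noteq> 0" "u \<noteq> 0" using assms by auto
  have \<kappa>u: "\<kappa> * u = (u - t) * (t - s)" using w \<kappa> by simp
  have "(u - t) / (u - s) = (u - t) * (u - s) / (u - s)\<^sup>2"
    using w by (simp add: power2_eq_square)
  then have a: "(u - t) / (u - s) * (x * x) = ((u - t)\<^sup>2 + \<kappa> * u) / (u - s)\<^sup>2 * (x * x)"
    unfolding \<kappa>u by (simp add: power2_eq_square algebra_simps)
  have L: "((u - t) / (u - s) * x + (t - s) / (u - s) * y)\<^sup>2
      = ((u - t) * x + (t - s) * y)\<^sup>2 / (u - s)\<^sup>2"
    by (simp add: add_divide_distrib[symmetric] power_divide)
  show ?thesis
    unfolding a L using w(1) by (simp add: divide_simps) (simp add: algebra_simps power2_eq_square)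
qed

section \<open>Joint moments of bounded variables determine integrals\<close>

text \<open>Measurability refers to \<open>F\<close>, the bound to the null sets of \<open>M\<close>; \<open>F\<close> will be a
  sub-\<open>\<sigma>\<close>-algebra that need not contain them.\<close>

definition ess_bounded :: "'a measure \<Rightarrow> 'a measure \<Rightarrow> ('a \<Rightarrow> real) \<Rightarrow> bool" where
  "ess_bounded M F f \<longleftrightarrow> f \<in> borel_measurable F \<and> (\<exists>C. AE \<omega> in M. \<bar>f \<omega>\<bar> \<le> C)"

lemma ess_bounded_const [intro, simp]: "ess_bounded M F (\<lambda>_. c)"
  unfolding ess_bounded_def by auto

lemma ess_bounded_add [intro]:
  assumes "ess_bounded M F f" "ess_bounded M F g"
  shows "ess_bounded M F (\<lambda>\<omega>. f \<omega> + g \<omega>)"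
proof -
  obtain C D where "AE \<omega> in M. \<bar>f \<omega>\<bar> \<le> C" "AE \<omega> in M. \<bar>g \<omega>\<bar> \<le> D"
    using assms unfolding ess_bounded_def by blast
  then have "AE \<omega> in M. \<bar>f \<omega> + g \<omega>\<bar> \<le> C + D"
    by eventually_elim linarith
  then show ?thesis using assms unfolding ess_bounded_def by (auto intro: borel_measurable_add)
qed

lemma ess_bounded_mult [intro]:
  assumes "ess_bounded M F f" "ess_bounded M F g"
  shows "ess_bounded M F (\<lambda>\<omega>. f \<omega> * g \<omega>)"
proof -
  obtain C D where "AE \<omega> in M. \<bar>f \<omega>\<bar> \<le> C" "AE \<omega> in M. \<bar>g \<omega>\<bar> \<le> D"
    using assms unfolding ess_bounded_def by blast
  then have "AE \<omega> in M. \<bar>f \<omega> * g \<omega>\<bar> \<le> C * D"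
    by eventually_elim (auto simp: abs_mult intro!: mult_mono)
  then show ?thesis using assms unfolding ess_bounded_def by (auto intro: borel_measurable_times)
qed

lemma ess_bounded_diff [intro]:
  assumes "ess_bounded M F f" "ess_bounded M F g"
  shows "ess_bounded M F (\<lambda>\<omega>. f \<omega> - g \<omega>)"
  using ess_bounded_add[OF assms(1) ess_bounded_mult[OF ess_bounded_const[of M F "-1"] assms(2)]]
  by simp

lemma ess_bounded_power [intro]:
  "ess_bounded M F f \<Longrightarrow> ess_bounded M F (\<lambda>\<omega>. f \<omega> ^ n)"
  by (induction n) auto

lemma ess_bounded_prod [intro]:
  "(\<And>j. j \<in> J \<Longrightarrow> ess_bounded M F (f j)) \<Longrightarrow> ess_bounded M F (\<lambda>\<omega>. \<Prod>j\<in>J. f j \<omega>)"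
  by (induction J rule: infinite_finite_induct) auto

lemma ess_bounded_poly [intro]:
  "ess_bounded M F f \<Longrightarrow> ess_bounded M F (\<lambda>\<omega>. poly p (f \<omega>))"
  by (induction p) auto

lemma ess_bounded_subalgebra:
  "subalgebra M F \<Longrightarrow> ess_bounded M F f \<Longrightarrow> ess_bounded M M f"
  unfolding ess_bounded_def by (auto intro: measurable_from_subalg)

lemma (in finite_measure) ess_bounded_integrable:
  "ess_bounded M M f \<Longrightarrow> integrable M f"
  unfolding ess_bounded_def by (auto intro!: integrable_const_bound)

lemma integrable_mult_ess_bounded:
  assumes "integrable M Y" "ess_bounded M M f"
  shows "integrable M (\<lambda>\<omega>. Y \<omega> * f \<omega>)"
proof -
  obtain C where "AE \<omega> in M. \<bar>f \<omega>\<bar> \<le> C" using assms unfolding ess_bounded_def by blast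
  then have "AE \<omega> in M. norm (Y \<omega> * f \<omega>) \<le> norm (C * Y \<omega>)"
  proof eventually_elim
    case (elim \<omega>)
    then have "\<bar>f \<omega>\<bar> * \<bar>Y \<omega>\<bar> \<le> \<bar>C\<bar> * \<bar>Y \<omega>\<bar>" by (intro mult_right_mono) auto
    then show ?case by (simp add: abs_mult mult.commute)
  qed
  moreover have "integrable M (\<lambda>\<omega>. C * Y \<omega>)" using assms by simp
  moreover have "(\<lambda>\<omega>. Y \<omega> * f \<omega>) \<in> borel_measurable M"
    using assms unfolding ess_bounded_def by auto
  ultimately show ?thesis by (metis Bochner_Integration.integrable_bound)
qed

lemma le_zero_of_le_mult:
  fixes c K :: real
  assumes "\<And>e. e > 0 \<Longrightarrow> c \<le> e * K" "K \<ge> 0"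
  shows "c \<le> 0"
proof (rule field_le_epsilon)
  fix e :: real assume "e > 0"
  then have "c \<le> e / (K + 1) * K" using assms(1)[of "e / (K + 1)"] assms(2) \<open>e > 0\<close> by simp
  also have "\<dots> \<le> e" using assms \<open>e > 0\<close> by (simp add: field_simps)
  finally show "c \<le> 0 + e" by simp
qed

text \<open>The sets with vanishing integral form a Dynkin system. Carrying a map \<open>X\<close> along covers Borel
  sets on the line and, for the identity, sub-\<open>\<sigma>\<close>-algebras of \<open>M\<close>.\<close>

lemma integral_zero_on_generated_sigma:
  fixes Y :: "'a \<Rightarrow> real"
  assumes Y: "integrable M Y" and X: "X \<in> measurable M N"
    and G: "Int_stable G" "G \<subseteq> Pow (space N)" "sets N = sigma_sets (space N) G"
    and total: "(\<integral>\<omega>. Y \<omega> \<partial>M) = 0"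
    and zero: "\<And>A. A \<in> G \<Longrightarrow> (\<integral>\<omega>. Y \<omega> * indicator A (X \<omega>) \<partial>M) = 0"
    and A: "A \<in> sets N"
  shows "(\<integral>\<omega>. Y \<omega> * indicator A (X \<omega>) \<partial>M) = 0"
proof -
  have int: "integrable M (\<lambda>\<omega>. Y \<omega> * indicator A (X \<omega>))" if "A \<in> sets N" for A
  proof -
    have "(\<lambda>\<omega>. indicator A (X \<omega>) :: real) \<in> borel_measurable M"
      using X that by measurable
    then show ?thesis
      by (intro integrable_mult_ess_bounded[OF Y])
        (auto simp: ess_bounded_def intro!: exI[of _ 1] split: split_indicator)
  qed
  show ?thesis using G(1,2) A[unfolded G(3)]
  proof (induction rule: sigma_sets_induct_disjoint)
    case (basic A)
    then show ?case by (rule zero)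
  next
    case empty
    show ?case by simp
  next
    case (compl A)
    have "(\<integral>\<omega>. Y \<omega> * indicator (space N - A) (X \<omega>) \<partial>M)
        = (\<integral>\<omega>. Y \<omega> - Y \<omega> * indicator A (X \<omega>) \<partial>M)"
      using measurable_space[OF X]
      by (intro Bochner_Integration.integral_cong) (auto split: split_indicator)
    also have "\<dots> = 0"
      using int[of A] compl Y total G(3) by simp
    finally show ?case .
  next
    case (union A)
    have AN: "A i \<in> sets N" for i using union(2) G(3) by auto
    have "((\<lambda>k. \<integral>\<omega>. Y \<omega> * (\<Sum>i<k. indicator (A i) (X \<omega>)) \<partial>M)
        \<longlonglongrightarrow> (\<integral>\<omega>. Y \<omega> * indicator (\<Union>i. A i) (X \<omega>) \<partial>M))"
    proof (rule integral_dominated_convergence[where w = "\<lambda>\<omega>. \<bar>Y \<omega>\<bar>"])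
      have "(\<lambda>\<omega>. indicator (A i) (X \<omega>) :: real) \<in> borel_measurable M" for i
        using X AN by measurable
      then show "(\<lambda>\<omega>. Y \<omega> * (\<Sum>i<k. indicator (A i) (X \<omega>))) \<in> borel_measurable M" for k
        using Y by measurable
      show "(\<lambda>\<omega>. Y \<omega> * indicator (\<Union>i. A i) (X \<omega>)) \<in> borel_measurable M"
        using int[of "\<Union>i. A i"] AN by auto
      have "(\<lambda>i. indicator (A i) x :: real) sums indicator (\<Union>i. A i) x" for x
        using union(1) by (intro indicator_sums) (auto simp: disjoint_family_on_def)
      then show "AE \<omega> in M. (\<lambda>k. Y \<omega> * (\<Sum>i<k. indicator (A i) (X \<omega>)))
          \<longlonglongrightarrow> Y \<omega> * indicator (\<Union>i. A i) (X \<omega>)"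
        unfolding sums_def by (intro AE_I2 tendsto_mult tendsto_const)
      have "(\<Sum>i<k. indicator (A i) x :: real) = indicator (\<Union>i<k. A i) x" for k x
        by (rule indicator_UN_disjoint[symmetric])
          (use union(1) in \<open>auto simp: disjoint_family_on_def\<close>)
      then show "AE \<omega> in M. norm (Y \<omega> * (\<Sum>i<k. indicator (A i) (X \<omega>))) \<le> \<bar>Y \<omega>\<bar>" for k
        by (auto split: split_indicator)
    qed (use Y in auto)
    moreover have "(\<integral>\<omega>. Y \<omega> * (\<Sum>i<k. indicator (A i) (X \<omega>)) \<partial>M) = 0" for k
      unfolding sum_distrib_left
      by (subst Bochner_Integration.integral_sum) (use int[OF AN] union(3) in auto)
    ultimately show ?case by (simp add: LIMSEQ_const_iff)
  qed
qed

text \<open>The measure with density \<open>Y\<close>, transported by \<open>X\<close>, is a signed measure of bounded support all of whose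
  moments vanish. By the Weierstrass theorem it annihilates continuous functions, hence
  half-lines by dominated convergence, hence Borel sets.\<close>

lemma moments_zero_imp_borel_zero:
  fixes X Y :: "'a \<Rightarrow> real"
  assumes Y: "integrable M Y" and X: "ess_bounded M M X"
    and zero: "\<And>n. (\<integral>\<omega>. Y \<omega> * X \<omega> ^ n \<partial>M) = 0"
    and A: "A \<in> sets borel"
  shows "(\<integral>\<omega>. Y \<omega> * indicator A (X \<omega>) \<partial>M) = 0"
proof -
  have [measurable]: "X \<in> borel_measurable M" using X unfolding ess_bounded_def by simp
  have [measurable]: "Y \<in> borel_measurable M" using Y by simp
  obtain C where C: "AE \<omega> in M. \<bar>X \<omega>\<bar> \<le> C" using X unfolding ess_bounded_def by blast
  have poly_zero: "(\<integral>\<omega>. Y \<omega> * g (X \<omega>) \<partial>M) = 0" if g: "real_polynomial_function g" for g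
  proof -
    obtain a n where "g = (\<lambda>x. \<Sum>i\<le>n. a i * x ^ i)"
      using g real_polynomial_function_iff_sum by blast
    then have "(\<integral>\<omega>. Y \<omega> * g (X \<omega>) \<partial>M) = (\<integral>\<omega>. (\<Sum>i\<le>n. a i * (Y \<omega> * X \<omega> ^ i)) \<partial>M)"
      by (simp add: sum_distrib_left mult.left_commute)
    also have "\<dots> = (\<Sum>i\<le>n. a i * (\<integral>\<omega>. Y \<omega> * X \<omega> ^ i \<partial>M))"
    proof -
      have "integrable M (\<lambda>\<omega>. a i * (Y \<omega> * X \<omega> ^ i))" for i
        using integrable_mult_ess_bounded[OF Y ess_bounded_power[OF X, of i]] by simp
      then show ?thesis by simp
    qed
    also have "\<dots> = 0" by (simp add: zero)
    finally show ?thesis .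
  qed
  have cont_zero: "(\<integral>\<omega>. Y \<omega> * g (X \<omega>) \<partial>M) = 0"
    if g: "continuous_on UNIV g" and g1: "\<And>x. \<bar>g x\<bar> \<le> 1" for g :: "real \<Rightarrow> real"
  proof -
    have [measurable]: "g \<in> borel_measurable borel"
      using g by (rule borel_measurable_continuous_onI)
    have ig: "integrable M (\<lambda>\<omega>. Y \<omega> * g (X \<omega>))"
      by (rule integrable_mult_ess_bounded[OF Y]) (auto simp: ess_bounded_def intro!: exI[of _ 1] g1)
    have "\<bar>\<integral>\<omega>. Y \<omega> * g (X \<omega>) \<partial>M\<bar> \<le> e * (\<integral>\<omega>. \<bar>Y \<omega>\<bar> \<partial>M)" if "e > 0" for e
    proof -
      obtain h where h: "real_polynomial_function h" "\<And>x. x \<in> {-C..C} \<Longrightarrow> \<bar>g x - h x\<bar> < e"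
        using that by (rule Stone_Weierstrass_real_polynomial_function[OF compact_Icc[of "- C" C]
              continuous_on_subset[OF g subset_UNIV] \<open>e > 0\<close>])
      have [measurable]: "h \<in> borel_measurable borel"
      proof (rule borel_measurable_continuous_onI)
        show "continuous_on UNIV h"
          by (rule continuous_on_polymonial_function) (use h(1) real_polynomial_function_eq in blast)
      qed
      have AEb: "AE \<omega> in M. norm (Y \<omega> * (g (X \<omega>) - h (X \<omega>))) \<le> e * \<bar>Y \<omega>\<bar>"
        using C
      proof eventually_elim
        case (elim \<omega>)
        then have "X \<omega> \<in> {-C..C}" by auto
        then have "\<bar>g (X \<omega>) - h (X \<omega>)\<bar> \<le> e" using h(2) by (simp add: less_imp_le)
        then have "\<bar>g (X \<omega>) - h (X \<omega>)\<bar> * \<bar>Y \<omega>\<bar> \<le> e * \<bar>Y \<omega>\<bar>"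
          by (rule mult_right_mono) simp
        then show ?case by (simp add: abs_mult mult.commute)
      qed
      have id: "integrable M (\<lambda>\<omega>. Y \<omega> * (g (X \<omega>) - h (X \<omega>)))"
      proof (rule Bochner_Integration.integrable_bound)
        show "integrable M (\<lambda>\<omega>. e * \<bar>Y \<omega>\<bar>)" using Y by simp
        show "AE \<omega> in M. norm (Y \<omega> * (g (X \<omega>) - h (X \<omega>))) \<le> norm (e * \<bar>Y \<omega>\<bar>)"
          using AEb
        proof eventually_elim
          case (elim \<omega>)
          then show ?case using abs_ge_self[of "e * \<bar>Y \<omega>\<bar>"] unfolding real_norm_def by linarith
        qed
      qed measurable
      have ih: "integrable M (\<lambda>\<omega>. Y \<omega> * h (X \<omega>))"
        using Bochner_Integration.integrable_diff[OF ig id] by (simp add: algebra_simps)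
      have "(\<integral>\<omega>. Y \<omega> * g (X \<omega>) \<partial>M) =
          (\<integral>\<omega>. Y \<omega> * (g (X \<omega>) - h (X \<omega>)) \<partial>M)"
        using ig ih poly_zero[OF h(1)] by (simp add: right_diff_distrib)
      also have "\<bar>\<dots>\<bar> \<le> (\<integral>\<omega>. norm (Y \<omega> * (g (X \<omega>) - h (X \<omega>))) \<partial>M)"
        using integral_norm_bound[of M "\<lambda>\<omega>. Y \<omega> * (g (X \<omega>) - h (X \<omega>))"] by simp
      also have "\<dots> \<le> (\<integral>\<omega>. e * \<bar>Y \<omega>\<bar> \<partial>M)"
        using id Y AEb by (intro integral_mono_AE integrable_norm) auto
      finally show ?thesis by simp
    qed
    then have "\<bar>\<integral>\<omega>. Y \<omega> * g (X \<omega>) \<partial>M\<bar> \<le> 0"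
      by (rule le_zero_of_le_mult) auto
    then show ?thesis by simp
  qed
  have closed_zero: "(\<integral>\<omega>. Y \<omega> * indicator {..a} (X \<omega>) \<partial>M) = 0" for a
  proof -
    \<comment> \<open>a continuous piecewise linear approximation of the indicator from above\<close>
    define g where "g k x = max 0 (min 1 (1 - real k * (x - a)))" for k x
    have lim: "(\<lambda>k. g k x) \<longlonglongrightarrow> indicator {..a} x" for x
    proof (cases "x \<le> a")
      case True
      then have "g k x = 1" for k
        by (auto simp: g_def mult_nonneg_nonpos)
      then show ?thesis using True by simp
    next
      case False
      then obtain N where N: "1 < real N * (x - a)"
        using ex_less_of_nat_mult[of "x - a" 1] by auto
      have "g k x = 0" if "k \<ge> N" for k
      proof -
        have "real N * (x - a) \<le> real k * (x - a)"
          using that False by (intro mult_right_mono) auto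
        then show ?thesis using N by (simp add: g_def)
      qed
      then have "eventually (\<lambda>k. g k x = indicator {..a} x) sequentially"
        using False by (auto simp: eventually_sequentially)
      then show ?thesis by (rule tendsto_eventually)
    qed
    have g1: "\<bar>g k x\<bar> \<le> 1" for k x by (auto simp: g_def)
    have [measurable]: "g k \<in> borel_measurable borel" for k unfolding g_def by measurable
    have "(\<lambda>k. \<integral>\<omega>. Y \<omega> * g k (X \<omega>) \<partial>M) \<longlonglongrightarrow> (\<integral>\<omega>. Y \<omega> * indicator {..a} (X \<omega>) \<partial>M)"
    proof (rule integral_dominated_convergence[where w = "\<lambda>\<omega>. \<bar>Y \<omega>\<bar>"])
      show "AE \<omega> in M. (\<lambda>k. Y \<omega> * g k (X \<omega>)) \<longlonglongrightarrow> Y \<omega> * indicator {..a} (X \<omega>)"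
        by (auto intro!: tendsto_mult lim)
      show "AE \<omega> in M. norm (Y \<omega> * g k (X \<omega>)) \<le> \<bar>Y \<omega>\<bar>" for k
        using g1 by (auto simp: abs_mult intro!: mult_left_le)
    qed (use Y in auto)
    moreover have "(\<integral>\<omega>. Y \<omega> * g k (X \<omega>) \<partial>M) = 0" for k
      by (rule cont_zero) (auto simp: g_def intro!: continuous_intros)
    ultimately show ?thesis by (simp add: LIMSEQ_const_iff)
  qed
  show ?thesis
  proof (rule integral_zero_on_generated_sigma[OF Y, where N = borel and G = "range atMost"])
    show "Int_stable (range atMost :: real set set)"
      by (auto simp: Int_stable_def Int_atMost)
    show "sets borel = sigma_sets (space borel) (range atMost :: real set set)"
      using arg_cong[OF borel_eq_atMost, of sets] by simp
    show "(\<integral>\<omega>. Y \<omega> \<partial>M) = 0" using zero[of 0] by simp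
  qed (use A closed_zero in auto)
qed

text \<open>The finite-dimensional cylinders are an intersection-stable generator, so it is enough to pass from monomials
  to products of indicators. This is done one coordinate at a time, with the remaining factors
  absorbed into \<open>Y\<close>.\<close>

lemma joint_moments_zero_imp_sigma_zero:
  fixes X :: "real \<Rightarrow> 'a \<Rightarrow> real"
  assumes Y: "integrable M Y" and X: "\<And>r. r \<in> T \<Longrightarrow> ess_bounded M M (X r)"
    and zero: "\<And>J n. finite J \<Longrightarrow> J \<subseteq> T \<Longrightarrow> (\<integral>\<omega>. Y \<omega> * (\<Prod>j\<in>J. X j \<omega> ^ n j) \<partial>M) = 0"
    and A: "A \<in> sets (sigma_gen M X T)"
  shows "(\<integral>\<omega>. Y \<omega> * indicator A \<omega> \<partial>M) = 0"
proof -
  have Xm: "X r \<in> borel_measurable M" if "r \<in> T" for r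
    using X[OF that] unfolding ess_bounded_def by simp
  have cyl: "(\<integral>\<omega>. Y \<omega> * (\<Prod>j\<in>J. indicator (B j) (X j \<omega>)) \<partial>M) = 0"
    if "finite J" "J \<subseteq> T" "\<And>j. j \<in> J \<Longrightarrow> B j \<in> sets borel" "integrable M Y"
      "\<And>n. (\<integral>\<omega>. Y \<omega> * (\<Prod>j\<in>J. X j \<omega> ^ n j) \<partial>M) = 0" for J B and Y :: "'a \<Rightarrow> real"
    using that
  proof (induction J arbitrary: Y rule: finite_induct)
    case empty
    then show ?case by simp
  next
    case (insert i J)
    have bd: "ess_bounded M M (\<lambda>\<omega>. \<Prod>j\<in>J. indicator (B j) (X j \<omega>) :: real)"
    proof (rule ess_bounded_prod)
      fix j assume "j \<in> J"
      then have "(\<lambda>\<omega>. indicator (B j) (X j \<omega>) :: real) \<in> borel_measurable M"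
        using Xm[of j] insert.prems(1,2)
        by (intro borel_measurable_indicator' measurable_compose[OF Xm]) auto
      then show "ess_bounded M M (\<lambda>\<omega>. indicator (B j) (X j \<omega>) :: real)"
        by (auto simp: ess_bounded_def intro!: exI[of _ 1] split: split_indicator)
    qed
    \<comment> \<open>the induction hypothesis with the power of \<open>X i\<close> moved into the density\<close>
    have "(\<integral>\<omega>. (Y \<omega> * (\<Prod>j\<in>J. indicator (B j) (X j \<omega>))) * X i \<omega> ^ m \<partial>M) = 0" for m
    proof -
      have "(\<integral>\<omega>. (Y \<omega> * X i \<omega> ^ m) * (\<Prod>j\<in>J. indicator (B j) (X j \<omega>)) \<partial>M) = 0"
      proof (rule insert.IH)
        show "integrable M (\<lambda>\<omega>. Y \<omega> * X i \<omega> ^ m)"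
          using insert.prems by (intro integrable_mult_ess_bounded ess_bounded_power X) auto
        show "(\<integral>\<omega>. (Y \<omega> * X i \<omega> ^ m) * (\<Prod>j\<in>J. X j \<omega> ^ n j) \<partial>M) = 0" for n
        proof -
          have "(\<Prod>j\<in>J. X j \<omega> ^ (n(i := m)) j) = (\<Prod>j\<in>J. X j \<omega> ^ n j)" for \<omega>
            using insert.hyps(2) by (intro prod.cong) auto
          then show ?thesis
            using insert.prems(4)[of "n(i := m)"] insert.hyps by (simp add: mult.assoc)
        qed
      qed (use insert.prems in auto)
      then show ?thesis by (simp add: ac_simps)
    qed
    then have "(\<integral>\<omega>. (Y \<omega> * (\<Prod>j\<in>J. indicator (B j) (X j \<omega>))) * indicator (B i) (X i \<omega>) \<partial>M) = 0"
      using insert.prems bd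
      by (intro moments_zero_imp_borel_zero integrable_mult_ess_bounded X) auto
    then show ?case using insert.hyps by (simp add: ac_simps)
  qed
  define G where "G = {(\<Inter>j\<in>J. X j -` B j) \<inter> space M | J B.
      finite J \<and> J \<subseteq> T \<and> (\<forall>j\<in>J. B j \<in> sets borel)}"
  have space: "space (sigma_gen M X T) = space M"
    unfolding sigma_gen_def by (auto intro!: space_measure_of)
  have sets_gen: "sets (sigma_gen M X T) =
      sigma_sets (space M) {X r -` A \<inter> space M | r A. r \<in> T \<and> A \<in> sets borel}"
    unfolding sigma_gen_def by (auto intro!: sets_measure_of)
  show ?thesis
  proof (rule integral_zero_on_generated_sigma[OF Y, where X = "\<lambda>\<omega>. \<omega>" and G = G])
    have "sets (sigma_gen M X T) \<subseteq> sets M"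
      unfolding sets_gen
      by (rule sets.sigma_sets_subset) (auto intro!: measurable_sets Xm)
    then show "(\<lambda>\<omega>. \<omega>) \<in> measurable M (sigma_gen M X T)"
      by (intro measurableI) (auto simp: space)
    show "Int_stable G"
    proof (rule Int_stableI)
      fix a b assume "a \<in> G" "b \<in> G"
      then obtain J B J' B' where J: "finite J" "J \<subseteq> T" "\<forall>j\<in>J. B j \<in> sets borel"
          "a = (\<Inter>j\<in>J. X j -` B j) \<inter> space M"
        and J': "finite J'" "J' \<subseteq> T" "\<forall>j\<in>J'. B' j \<in> sets borel"
          "b = (\<Inter>j\<in>J'. X j -` B' j) \<inter> space M"
        unfolding G_def by blast
      have "a \<inter> b = (\<Inter>j\<in>J \<union> J'. X j -` ((if j \<in> J then B j else UNIV)
          \<inter> (if j \<in> J' then B' j else UNIV))) \<inter> space M"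
        unfolding J J' by (auto split: if_splits)
      then show "a \<inter> b \<in> G"
        unfolding G_def using J J'
        by (intro CollectI exI[of _ "J \<union> J'"] exI[of _ "\<lambda>j. (if j \<in> J then B j else UNIV)
          \<inter> (if j \<in> J' then B' j else UNIV)"]) auto
    qed
    show "G \<subseteq> Pow (space (sigma_gen M X T))" by (auto simp: G_def space)
    show "sets (sigma_gen M X T) = sigma_sets (space (sigma_gen M X T)) G"
      unfolding sets_gen space
    proof (intro antisym sigma_sets_mono subsetI)
      fix a assume "a \<in> {X r -` A \<inter> space M | r A. r \<in> T \<and> A \<in> sets borel}"
      then obtain r B where "r \<in> T" "B \<in> sets borel" "a = X r -` B \<inter> space M" by blast
      then have "a \<in> G"
        unfolding G_def by (intro CollectI exI[of _ "{r}"] exI[of _ "\<lambda>_. B"]) auto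
      then show "a \<in> sigma_sets (space M) G" by auto
    next
      fix a assume "a \<in> G"
      then obtain J B where J: "finite J" "J \<subseteq> T" "\<forall>j\<in>J. B j \<in> sets borel"
          "a = (\<Inter>j\<in>J. X j -` B j) \<inter> space M"
        unfolding G_def by blast
      have "(\<Inter>j\<in>J. X j -` B j) \<inter> space M \<in> sets (sigma_gen M X T)"
        using J(1-3)
      proof (induction J rule: finite_induct)
        case empty
        show ?case using sets.top[of "sigma_gen M X T"] by (simp add: space)
      next
        case (insert i J)
        have "X i -` B i \<inter> space M \<in> sets (sigma_gen M X T)"
          unfolding sets_gen using insert.prems by (intro sigma_sets.Basic) auto
        moreover have "(\<Inter>j\<in>insert i J. X j -` B j) \<inter> space M =
            (X i -` B i \<inter> space M) \<inter> ((\<Inter>j\<in>J. X j -` B j) \<inter> space M)" by auto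
        ultimately show ?case using insert by auto
      qed
      then show "a \<in> sigma_sets (space M) {X r -` A \<inter> space M | r A. r \<in> T \<and> A \<in> sets borel}"
        unfolding sets_gen[symmetric] J(4) .
    qed
    show "(\<integral>\<omega>. Y \<omega> \<partial>M) = 0" using zero[of "{}"] by simp
    fix a assume "a \<in> G"
    then obtain J B where J: "finite J" "J \<subseteq> T" "\<forall>j\<in>J. B j \<in> sets borel"
        "a = (\<Inter>j\<in>J. X j -` B j) \<inter> space M"
      unfolding G_def by blast
    have "indicator a \<omega> = (\<Prod>j\<in>J. indicator (B j) (X j \<omega>) :: real)" if "\<omega> \<in> space M" for \<omega>
      using that J(1) unfolding J(4)
      by (cases "\<forall>j\<in>J. X j \<omega> \<in> B j") (auto simp: indicator_def)
    then have "(\<integral>\<omega>. Y \<omega> * indicator a \<omega> \<partial>M)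
        = (\<integral>\<omega>. Y \<omega> * (\<Prod>j\<in>J. indicator (B j) (X j \<omega>)) \<partial>M)"
      by (intro Bochner_Integration.integral_cong) auto
    then show "(\<integral>\<omega>. Y \<omega> * indicator a \<omega> \<partial>M) = 0"
      using cyl[OF J(1,2) _ Y zero[OF J(1,2)]] J(3) by simp
  qed (rule A)
qed

section \<open>Conditional expectations through kernels\<close>

lemma space_sigma_gen [simp]: "space (sigma_gen M X T) = space M"
  unfolding sigma_gen_def by (auto intro!: space_measure_of)

lemma sets_sigma_gen:
  "sets (sigma_gen M X T) =
     sigma_sets (space M) {X r -` A \<inter> space M | r A. r \<in> T \<and> A \<in> sets borel}"
  unfolding sigma_gen_def by (auto intro!: sets_measure_of)

lemma measurable_sigma_gen:
  "r \<in> T \<Longrightarrow> X r \<in> borel_measurable (sigma_gen M X T)"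
  by (intro measurableI) (auto simp: sets_sigma_gen intro!: sigma_sets.Basic)

lemma subalgebra_sigma_gen:
  assumes "\<And>r. r \<in> T \<Longrightarrow> X r \<in> borel_measurable M"
  shows "subalgebra M (sigma_gen M X T)"
proof -
  have "sets (sigma_gen M X T) \<subseteq> sets M"
    unfolding sets_sigma_gen
    by (rule sets.sigma_sets_subset) (use assms in \<open>auto intro!: measurable_sets\<close>)
  then show ?thesis unfolding subalgebra_def by simp
qed

lemma ess_bounded_sigma_gen_mono:
  assumes "T \<subseteq> T'" "ess_bounded M (sigma_gen M X T) f"
  shows "ess_bounded M (sigma_gen M X T') f"
proof -
  have "subalgebra (sigma_gen M X T') (sigma_gen M X T)"
    unfolding subalgebra_def sets_sigma_gen using assms(1) by (auto intro!: sigma_sets_mono')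
  then show ?thesis using assms(2) unfolding ess_bounded_def by (auto intro: measurable_from_subalg)
qed

lemma floor_step_bounds:
  fixes f :: "real \<Rightarrow> real"
  assumes "k > 0"
  shows "of_int \<lfloor>of_nat k * f y\<rfloor> / of_nat k \<le> f y"
    and "f y \<le> of_int \<lfloor>of_nat k * f y\<rfloor> / of_nat k + 1 / of_nat k"
proof -
  have "of_int \<lfloor>of_nat k * f y\<rfloor> \<le> of_nat k * f y" by (rule of_int_floor_le)
  then show "of_int \<lfloor>of_nat k * f y\<rfloor> / of_nat k \<le> f y"
    using assms by (simp add: field_simps)
  have "of_nat k * f y \<le> of_int \<lfloor>of_nat k * f y\<rfloor> + 1" by linarith
  then show "f y \<le> of_int \<lfloor>of_nat k * f y\<rfloor> / of_nat k + 1 / of_nat k"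
    using assms by (simp add: field_simps)
qed

text \<open>The kernel \<open>K\<close> need not be measurable in \<open>\<omega>\<close>, so \<open>\<integral>f \<partial>K \<omega>\<close> cannot be integrated over
  \<open>\<omega>\<close>. Instead \<open>f\<close> is enclosed between a step function and its translate by \<open>1/k\<close>;
  both sides of the claim are monotone in \<open>f\<close>, and on step functions they agree almost everywhere.\<close>

lemma cond_exp_eq_kernel_integral:
  fixes f :: "real \<Rightarrow> real" and Y :: "'a \<Rightarrow> real"
  assumes M: "prob_space M" and F: "subalgebra M F" and Y: "Y \<in> borel_measurable M"
    and K: "\<And>\<omega>. \<omega> \<in> space M \<Longrightarrow> prob_space (K \<omega>) \<and> sets (K \<omega>) = sets borel"
    and ind: "\<And>A. A \<in> sets borel \<Longrightarrow>
      AE \<omega> in M. real_cond_exp M F (\<lambda>\<omega>. indicator A (Y \<omega>)) \<omega> = measure (K \<omega>) A"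
    and f: "f \<in> borel_measurable borel" and bound: "\<And>y. \<bar>f y\<bar> \<le> C"
  shows "AE \<omega> in M. real_cond_exp M F (\<lambda>\<omega>. f (Y \<omega>)) \<omega> = (\<integral>y. f y \<partial>K \<omega>)"
proof -
  interpret prob_space M by (rule M)
  interpret finite_measure_subalgebra M F by unfold_locales (rule F)
  note [measurable] = Y f
  have int: "integrable M (\<lambda>\<omega>. g (Y \<omega>))" if "g \<in> borel_measurable borel" "\<And>y. \<bar>g y\<bar> \<le> D"
    for g :: "real \<Rightarrow> real" and D :: real
    using that by (intro integrable_const_bound[of _ D]) auto
  have close: "AE \<omega> in M. \<bar>real_cond_exp M F (\<lambda>\<omega>. f (Y \<omega>)) \<omega> - (\<integral>y. f y \<partial>K \<omega>)\<bar> \<le> 1 / real (Suc m)"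
    for m
  proof -
    define k where "k = Suc m"
    have k: "k > 0" by (simp add: k_def)
    define S where "S i = {y. \<lfloor>of_nat k * f y\<rfloor> = i}" for i
    define N where "N = \<lceil>of_nat k * C\<rceil> + 1"
    define g where "g y = (\<Sum>i\<in>{-N..N}. of_int i / of_nat k * indicator (S i) y :: real)" for y
    have [measurable]: "S i \<in> sets borel" for i unfolding S_def by measurable
    have g_eq: "g y = of_int \<lfloor>of_nat k * f y\<rfloor> / of_nat k" for y
    proof -
      have "\<bar>of_nat k * f y\<bar> \<le> of_nat k * C"
        using bound[of y] by (simp add: abs_mult mult_left_mono)
      then have "\<lfloor>of_nat k * f y\<rfloor> \<in> {-N..N}" unfolding N_def by (simp; linarith)
      moreover have "g y = (\<Sum>i\<in>{-N..N}. if \<lfloor>of_nat k * f y\<rfloor> = i then of_int i / of_nat k else 0)"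
        unfolding g_def S_def by (intro sum.cong) (auto simp: indicator_def)
      ultimately show ?thesis by (simp add: sum.delta')
    qed
    note g_le = floor_step_bounds[OF k, of f, folded g_eq]
    have [measurable]: "g \<in> borel_measurable borel" unfolding g_def by measurable
    have g_bound: "\<bar>g y\<bar> \<le> C + 1" for y
    proof -
      have "1 / of_nat k \<le> (1::real)" using k by simp
      then show ?thesis using g_le[of y] bound[of y] by linarith
    qed
    have ind_int: "integrable M (\<lambda>\<omega>. indicator (S i) (Y \<omega>) :: real)" for i
      by (rule int[of "indicator (S i)" 1]) (auto split: split_indicator)
    have "AE \<omega> in M. real_cond_exp M F (\<lambda>\<omega>. g (Y \<omega>)) \<omega> = (\<integral>y. g y \<partial>K \<omega>)"
    proof -
      have "AE \<omega> in M. real_cond_exp M F (\<lambda>\<omega>. g (Y \<omega>)) \<omega> =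
          (\<Sum>i\<in>{-N..N}. real_cond_exp M F (\<lambda>\<omega>. of_int i / of_nat k * indicator (S i) (Y \<omega>)) \<omega>)"
        unfolding g_def using ind_int by (intro real_cond_exp_sum) auto
      moreover have "AE \<omega> in M. \<forall>i\<in>{-N..N}.
          real_cond_exp M F (\<lambda>\<omega>. of_int i / of_nat k * indicator (S i) (Y \<omega>)) \<omega>
          = of_int i / of_nat k * real_cond_exp M F (\<lambda>\<omega>. indicator (S i) (Y \<omega>)) \<omega>"
        using ind_int by (intro AE_finite_allI real_cond_exp_cmult) auto
      moreover have "AE \<omega> in M. \<forall>i\<in>{-N..N}.
          real_cond_exp M F (\<lambda>\<omega>. indicator (S i) (Y \<omega>)) \<omega> = measure (K \<omega>) (S i)"
        by (intro AE_finite_allI ind) auto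
      ultimately show ?thesis
        using AE_space
      proof eventually_elim
        case (elim \<omega>)
        interpret K: prob_space "K \<omega>" using K elim by blast
        have sK: "S i \<in> sets (K \<omega>)" for i using K elim by simp
        have "(\<integral>y. g y \<partial>K \<omega>) = (\<Sum>i\<in>{-N..N}. of_int i / of_nat k * measure (K \<omega>) (S i))"
          unfolding g_def using sK K.emeasure_finite by (simp add: less_top[symmetric])
        then show ?case using elim by simp
      qed
    qed
    moreover have "AE \<omega> in M. real_cond_exp M F (\<lambda>\<omega>. g (Y \<omega>)) \<omega> \<le> real_cond_exp M F (\<lambda>\<omega>. f (Y \<omega>)) \<omega>"
      using g_le(1) by (intro real_cond_exp_mono int[OF _ bound] int[OF _ g_bound]) auto
    moreover have "AE \<omega> in M. real_cond_exp M F (\<lambda>\<omega>. f (Y \<omega>)) \<omega>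
        \<le> real_cond_exp M F (\<lambda>\<omega>. g (Y \<omega>) + 1 / of_nat k) \<omega>"
      using g_le(2)
      by (intro real_cond_exp_mono int[OF _ bound] Bochner_Integration.integrable_add int[OF _ g_bound]) auto
    moreover have "AE \<omega> in M. real_cond_exp M F (\<lambda>\<omega>. g (Y \<omega>) + 1 / of_nat k) \<omega>
        = real_cond_exp M F (\<lambda>\<omega>. g (Y \<omega>)) \<omega> + real_cond_exp M F (\<lambda>\<omega>. 1 / of_nat k) \<omega>"
      by (intro real_cond_exp_add int[OF _ g_bound]) auto
    moreover have "AE \<omega> in M. real_cond_exp M F (\<lambda>\<omega>. 1 / of_nat k) \<omega> = 1 / of_nat k"
      by (intro real_cond_exp_F_meas) auto
    ultimately show ?thesis
      using AE_space
    proof eventually_elim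
      case (elim \<omega>)
      interpret K: prob_space "K \<omega>" using K elim by blast
      have sK: "sets (K \<omega>) = sets borel" using K elim by simp
      have if': "integrable (K \<omega>) f"
        using bound by (auto intro!: K.integrable_const_bound[of _ C]
            simp: measurable_cong_sets[OF sK refl])
      have ig: "integrable (K \<omega>) g"
        using g_bound by (auto intro!: K.integrable_const_bound[of _ "C + 1"]
            simp: measurable_cong_sets[OF sK refl])
      have "(\<integral>y. g y \<partial>K \<omega>) \<le> (\<integral>y. f y \<partial>K \<omega>)"
        by (intro integral_mono if' ig g_le)
      moreover have "(\<integral>y. f y \<partial>K \<omega>) \<le> (\<integral>y. g y + 1 / of_nat k \<partial>K \<omega>)"
        by (intro integral_mono if' Bochner_Integration.integrable_add ig g_le) auto
      then have "(\<integral>y. f y \<partial>K \<omega>) \<le> (\<integral>y. g y \<partial>K \<omega>) + 1 / of_nat k"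
        using ig by (simp add: K.prob_space)
      ultimately show ?case using elim by (simp add: k_def[symmetric] abs_le_iff)
    qed
  qed
  then have "AE \<omega> in M. \<forall>m. \<bar>real_cond_exp M F (\<lambda>\<omega>. f (Y \<omega>)) \<omega> - (\<integral>y. f y \<partial>K \<omega>)\<bar> \<le> 1 / real (Suc m)"
    by (simp add: AE_all_countable)
  then show ?thesis
  proof eventually_elim
    case (elim \<omega>)
    have "\<bar>real_cond_exp M F (\<lambda>\<omega>. f (Y \<omega>)) \<omega> - (\<integral>y. f y \<partial>K \<omega>)\<bar> \<le> 0"
      using elim LIMSEQ_Suc[OF lim_1_over_n[where 'a = real]] by (intro LIMSEQ_le_const) auto
    then show ?case by simp
  qed
qed

text \<open>A polynomial is unbounded, but \<open>Y\<close> avoids the complement of some \<open>[-C, C]\<close>; by the assumption on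
  indicators almost every \<open>K \<omega>\<close> gives mass \<open>0\<close> to it too, so that the polynomial can be cut off.\<close>

lemma cond_exp_poly_eq_kernel_integral:
  fixes Y :: "'a \<Rightarrow> real"
  assumes M: "prob_space M" and F: "subalgebra M F" and Y: "ess_bounded M M Y"
    and K: "\<And>\<omega>. \<omega> \<in> space M \<Longrightarrow> prob_space (K \<omega>) \<and> sets (K \<omega>) = sets borel"
    and ind: "\<And>A. A \<in> sets borel \<Longrightarrow>
      AE \<omega> in M. real_cond_exp M F (\<lambda>\<omega>. indicator A (Y \<omega>)) \<omega> = measure (K \<omega>) A"
  shows "AE \<omega> in M. real_cond_exp M F (\<lambda>\<omega>. poly p (Y \<omega>)) \<omega> = (\<integral>y. poly p y \<partial>K \<omega>)"
proof -
  interpret prob_space M by (rule M)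
  interpret finite_measure_subalgebra M F by unfold_locales (rule F)
  have Ym [measurable]: "Y \<in> borel_measurable M" using Y unfolding ess_bounded_def by simp
  obtain C where C: "AE \<omega> in M. \<bar>Y \<omega>\<bar> \<le> C" using Y unfolding ess_bounded_def by blast
  have "AE \<omega> in M. real_cond_exp M F (\<lambda>\<omega>. indicator (- {-C..C}) (Y \<omega>)) \<omega>
      = real_cond_exp M F (\<lambda>\<omega>. 0) \<omega>"
    using C by (intro real_cond_exp_cong) (auto elim!: eventually_mono split: split_indicator)
  moreover have "AE \<omega> in M. real_cond_exp M F (\<lambda>\<omega>. 0) \<omega> = 0"
    by (intro real_cond_exp_F_meas) auto
  moreover have "AE \<omega> in M. real_cond_exp M F (\<lambda>\<omega>. indicator (- {-C..C}) (Y \<omega>)) \<omega>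
      = measure (K \<omega>) (- {-C..C})"
    by (rule ind) simp
  ultimately have supp: "AE \<omega> in M. AE y in K \<omega>. y \<in> {-C..C}"
    using AE_space
  proof eventually_elim
    case (elim \<omega>)
    interpret K: prob_space "K \<omega>" using K elim by blast
    have sK: "sets (K \<omega>) = sets borel" using K elim by simp
    have "measure (K \<omega>) (- {-C..C}) = 0" using elim by simp
    then have "- {-C..C} \<in> null_sets (K \<omega>)"
      using sK by (auto simp: null_sets_def K.emeasure_eq_measure)
    then show ?case by (rule AE_I'[of "- {-C..C}"]) auto
  qed
  define f where "f y = indicator {-C..C} y * poly p y" for y
  have [measurable]: "(\<lambda>y. poly p y) \<in> borel_measurable borel"
    by (intro borel_measurable_continuous_onI continuous_intros)
  then have [measurable]: "f \<in> borel_measurable borel" unfolding f_def by measurable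
  obtain D where "\<And>y. y \<in> {-C..C} \<Longrightarrow> \<bar>poly p y\<bar> \<le> D"
  proof -
    have "compact ((\<lambda>y. poly p y) ` {-C..C})"
      by (intro compact_continuous_image continuous_intros) auto
    then have "bounded ((\<lambda>y. poly p y) ` {-C..C})" by (rule compact_imp_bounded)
    then obtain D where "\<forall>z\<in>(\<lambda>y. poly p y) ` {-C..C}. norm z \<le> D"
      unfolding bounded_iff by blast
    then show thesis by (intro that[of D]) auto
  qed
  then have "\<bar>f y\<bar> \<le> max 0 D" for y
    unfolding f_def by (auto split: split_indicator simp: max.coboundedI2)
  then have "AE \<omega> in M. real_cond_exp M F (\<lambda>\<omega>. f (Y \<omega>)) \<omega> = (\<integral>y. f y \<partial>K \<omega>)"
    by (intro cond_exp_eq_kernel_integral[OF M F Ym K ind]) auto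
  moreover have "AE \<omega> in M. real_cond_exp M F (\<lambda>\<omega>. f (Y \<omega>)) \<omega>
      = real_cond_exp M F (\<lambda>\<omega>. poly p (Y \<omega>)) \<omega>"
    using C by (intro real_cond_exp_cong) (auto elim!: eventually_mono simp: f_def split: split_indicator)
  ultimately show ?thesis
    using supp AE_space
  proof eventually_elim
    case (elim \<omega>)
    have sK: "sets (K \<omega>) = sets borel" using K elim by simp
    have "(\<integral>y. f y \<partial>K \<omega>) = (\<integral>y. poly p y \<partial>K \<omega>)"
      using elim(3) by (intro integral_cong_AE) (auto simp: f_def measurable_cong_sets[OF sK refl])
    then show ?case using elim by simp
  qed
qed

section \<open>The free bi-Poisson process\<close>

locale free_bi_poisson = prob_space M
  for M :: "'a measure" +
  fixes \<eta> \<theta> :: real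
    and P :: "real \<Rightarrow> real \<Rightarrow> real \<Rightarrow> real measure"
    and X :: "real \<Rightarrow> 'a \<Rightarrow> real"
  assumes kernels: "transition_kernels \<eta> \<theta> P"
    and markov: "markov_process M (state_space \<eta>) P X"
    and start: "AE \<omega> in M. X 0 \<omega> = 0"
begin

abbreviation "p \<equiv> mart_poly \<eta> \<theta>"

lemma X_measurable: "0 \<le> t \<Longrightarrow> X t \<in> borel_measurable M"
  using markov unfolding markov_process_def by (auto simp: measurable_restrict_space2_iff)

lemma X_state_space: "0 \<le> t \<Longrightarrow> \<omega> \<in> space M \<Longrightarrow> X t \<omega> \<in> state_space \<eta>"
  using markov unfolding markov_process_def by (auto simp: measurable_restrict_space2_iff)

lemma kernel:
  "0 \<le> s \<Longrightarrow> s < t \<Longrightarrow> \<omega> \<in> space M \<Longrightarrow>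
     orthogonality_measure \<eta> \<theta> s t (X s \<omega>) (P s t (X s \<omega>))"
  using kernels X_state_space unfolding transition_kernels_def by blast

lemma markov_kernel:
  "0 \<le> s \<Longrightarrow> s < t \<Longrightarrow> A \<in> sets borel \<Longrightarrow>
     AE \<omega> in M. real_cond_exp M (sigma_gen M X {0..s}) (\<lambda>\<omega>. indicator A (X t \<omega>)) \<omega>
       = measure (P s t (X s \<omega>)) A"
  using markov unfolding markov_process_def by blast

lemma subalgebra_gen: "T \<subseteq> {0..} \<Longrightarrow> subalgebra M (sigma_gen M X T)"
  by (intro subalgebra_sigma_gen X_measurable) auto

text \<open>For \<open>t > 0\<close> the Markov property at time \<open>0\<close> makes \<open>P 0 t 0\<close> the law of \<open>X t\<close>, and
  the three-term recursion bounds the support of that measure.\<close>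

lemma X_bounded:
  assumes "0 \<le> t"
  shows "ess_bounded M M (X t)"
proof (cases "t = 0")
  case True
  have "AE \<omega> in M. \<bar>X 0 \<omega>\<bar> \<le> 0" using start by eventually_elim simp
  then show ?thesis using True X_measurable unfolding ess_bounded_def by blast
next
  case False
  then have t: "0 < t" using assms by simp
  let ?F = "sigma_gen M X {0..0}"
  interpret F: finite_measure_subalgebra M ?F
    by unfold_locales (rule subalgebra_gen, simp)
  have \<mu>: "orthogonality_measure \<eta> \<theta> 0 t 0 (P 0 t 0)"
    using kernels t unfolding transition_kernels_def state_space_def by simp
  then interpret \<mu>: prob_space "P 0 t 0" unfolding orthogonality_measure_def by blast
  have sets: "sets (P 0 t 0) = sets borel" using \<mu> unfolding orthogonality_measure_def by blast
  obtain R where "AE y in P 0 t 0. \<bar>y\<bar> \<le> R"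
  proof (rule that, rule three_term_support[OF three_term_Q])
    show "\<bar>\<integral>y. poly (Q \<eta> \<theta> 0 t 0 n) y \<partial>P 0 t 0\<bar> \<le> 1" for n
      using orthogonality_measure_moments(2)[OF \<mu>] by (cases n) (simp_all add: \<mu>.prob_space)
  qed (use \<mu>.prob_space_axioms sets orthogonality_measure_moments(1)[OF \<mu>] in auto)
  then have null: "measure (P 0 t 0) {y. \<not> \<bar>y\<bar> \<le> R} = 0"
    using sets sets_eq_imp_space_eq[OF sets] \<mu>.prob_Collect_eq_0[of "\<lambda>y. \<not> \<bar>y\<bar> \<le> R"] by simp
  let ?I = "\<lambda>\<omega>. indicator {y. \<not> \<bar>y\<bar> \<le> R} (X t \<omega>) :: real"
  have [measurable]: "X t \<in> borel_measurable M" using X_measurable assms by blast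
  have int: "integrable M ?I" by (intro integrable_const_bound[of _ 1]) (auto split: split_indicator)
  have "AE \<omega> in M. real_cond_exp M ?F ?I \<omega> = measure (P 0 t (X 0 \<omega>)) {y. \<not> \<bar>y\<bar> \<le> R}"
    by (rule markov_kernel) (use t in auto)
  then have "AE \<omega> in M. real_cond_exp M ?F ?I \<omega> = 0"
    using start by eventually_elim (simp add: null)
  then have "(\<integral>\<omega>. real_cond_exp M ?F ?I \<omega> \<partial>M) = (\<integral>\<omega>. 0 \<partial>M)"
    by (intro integral_cong_AE) auto
  then have "(\<integral>\<omega>. ?I \<omega> \<partial>M) = 0" using F.real_cond_exp_int(2)[OF int] by simp
  then have "AE \<omega> in M. ?I \<omega> = 0"
    using integral_nonneg_eq_0_iff_AE[OF int] by simp
  then have "AE \<omega> in M. \<bar>X t \<omega>\<bar> \<le> R"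
    by eventually_elim (simp split: split_indicator_asm)
  then show ?thesis unfolding ess_bounded_def by auto
qed

lemma past_ess_bounded:
  "0 \<le> r \<Longrightarrow> r \<le> s \<Longrightarrow> ess_bounded M (sigma_gen M X {0..s}) (X r)"
  using X_bounded[of r] measurable_sigma_gen[of r "{0..s}" X M] unfolding ess_bounded_def by auto

lemma past_mono:
  "r \<le> s \<Longrightarrow> ess_bounded M (sigma_gen M X {0..r}) Z \<Longrightarrow> ess_bounded M (sigma_gen M X {0..s}) Z"
  by (rule ess_bounded_sigma_gen_mono) auto

lemma past_ess_bounded_M: "ess_bounded M (sigma_gen M X {0..s}) Z \<Longrightarrow> ess_bounded M M Z"
  by (rule ess_bounded_subalgebra[OF subalgebra_gen]) auto

text \<open>The martingale property, tested against bounded functions of the past.\<close>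

lemma mart_poly_martingale:
  assumes "0 \<le> s" "s \<le> t" and Z: "ess_bounded M (sigma_gen M X {0..s}) Z"
  shows "(\<integral>\<omega>. Z \<omega> * poly (p t n) (X t \<omega>) \<partial>M) = (\<integral>\<omega>. Z \<omega> * poly (p s n) (X s \<omega>) \<partial>M)"
proof (cases "s = t")
  case False
  let ?F = "sigma_gen M X {0..s}"
  interpret F: finite_measure_subalgebra M ?F
    by unfold_locales (rule subalgebra_gen, simp)
  have st: "s < t" "0 \<le> t" using assms False by auto
  have "AE \<omega> in M. real_cond_exp M ?F (\<lambda>\<omega>. poly (p t n) (X t \<omega>)) \<omega>
      = (\<integral>y. poly (p t n) y \<partial>P s t (X s \<omega>))"
    using kernel[OF assms(1) st(1)] markov assms(1) st
    unfolding orthogonality_measure_def markov_process_def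
    by (intro cond_exp_poly_eq_kernel_integral X_bounded F.subalg prob_space_axioms) auto
  then have ce: "AE \<omega> in M. real_cond_exp M ?F (\<lambda>\<omega>. poly (p t n) (X t \<omega>)) \<omega> = poly (p s n) (X s \<omega>)"
    using AE_space by eventually_elim (simp add: integral_mart_poly kernel assms(1) st)
  have b: "ess_bounded M M (\<lambda>\<omega>. poly (p t n) (X t \<omega>))" "ess_bounded M M (\<lambda>\<omega>. poly (p s n) (X s \<omega>))"
    using X_bounded assms(1) st by auto
  have "(\<integral>\<omega>. Z \<omega> * poly (p t n) (X t \<omega>) \<partial>M)
      = (\<integral>\<omega>. Z \<omega> * real_cond_exp M ?F (\<lambda>\<omega>. poly (p t n) (X t \<omega>)) \<omega> \<partial>M)"
    using Z b(1) past_ess_bounded_M[OF Z]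
    by (intro F.real_cond_exp_intg(2)[symmetric] ess_bounded_integrable ess_bounded_mult)
      (auto simp: ess_bounded_def)
  also have "\<dots> = (\<integral>\<omega>. Z \<omega> * poly (p s n) (X s \<omega>) \<partial>M)"
  proof (rule integral_cong_AE)
    show "AE \<omega> in M. Z \<omega> * real_cond_exp M ?F (\<lambda>\<omega>. poly (p t n) (X t \<omega>)) \<omega>
        = Z \<omega> * poly (p s n) (X s \<omega>)"
      using ce by eventually_elim simp
  qed (use past_ess_bounded_M[OF Z] b in \<open>auto simp: ess_bounded_def\<close>)
  finally show ?thesis .
qed simp

text \<open>The transition operators map polynomials to polynomials; \<open>g\<close> does not depend on \<open>Z\<close>, so
  \<open>g(X\<^sub>s)\<close> is the conditional expectation of \<open>f(X\<^sub>t)\<close> given the past of \<open>s\<close>.\<close>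

lemma poly_conditional_poly:
  assumes "0 \<le> s" "s \<le> t"
  shows "\<exists>g. \<forall>Z. ess_bounded M (sigma_gen M X {0..s}) Z \<longrightarrow>
    (\<integral>\<omega>. Z \<omega> * poly f (X t \<omega>) \<partial>M) = (\<integral>\<omega>. Z \<omega> * poly g (X s \<omega>) \<partial>M)"
proof (rule three_term_span[OF three_term_mart_poly[of \<theta> t \<eta>]])
  have int: "integrable M (\<lambda>\<omega>. Z \<omega> * poly f (X r \<omega>))"
    if "ess_bounded M (sigma_gen M X {0..s}) Z" "0 \<le> r" for Z f r
    by (intro ess_bounded_integrable ess_bounded_mult ess_bounded_poly X_bounded
        past_ess_bounded_M[OF that(1)] that(2))
  note ints = int[OF _ assms(1)] int[OF _ order_trans[OF assms]]
  show "\<exists>g. \<forall>Z. ess_bounded M (sigma_gen M X {0..s}) Z \<longrightarrow>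
    (\<integral>\<omega>. Z \<omega> * poly (p t n) (X t \<omega>) \<partial>M) = (\<integral>\<omega>. Z \<omega> * poly g (X s \<omega>) \<partial>M)" for n
    using mart_poly_martingale[OF assms] by blast
  fix f assume "\<exists>g. \<forall>Z. ess_bounded M (sigma_gen M X {0..s}) Z \<longrightarrow>
    (\<integral>\<omega>. Z \<omega> * poly f (X t \<omega>) \<partial>M) = (\<integral>\<omega>. Z \<omega> * poly g (X s \<omega>) \<partial>M)"
  then obtain g where g: "\<And>Z. ess_bounded M (sigma_gen M X {0..s}) Z \<Longrightarrow>
    (\<integral>\<omega>. Z \<omega> * poly f (X t \<omega>) \<partial>M) = (\<integral>\<omega>. Z \<omega> * poly g (X s \<omega>) \<partial>M)" by blast
  show "\<exists>g. \<forall>Z. ess_bounded M (sigma_gen M X {0..s}) Z \<longrightarrow>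
    (\<integral>\<omega>. Z \<omega> * poly (smult c f) (X t \<omega>) \<partial>M) = (\<integral>\<omega>. Z \<omega> * poly g (X s \<omega>) \<partial>M)" for c
    using g by (intro exI[of _ "smult c g"]) (simp add: mult.left_commute)
  fix f' assume "\<exists>g. \<forall>Z. ess_bounded M (sigma_gen M X {0..s}) Z \<longrightarrow>
    (\<integral>\<omega>. Z \<omega> * poly f' (X t \<omega>) \<partial>M) = (\<integral>\<omega>. Z \<omega> * poly g (X s \<omega>) \<partial>M)"
  then obtain g' where g': "\<And>Z. ess_bounded M (sigma_gen M X {0..s}) Z \<Longrightarrow>
    (\<integral>\<omega>. Z \<omega> * poly f' (X t \<omega>) \<partial>M) = (\<integral>\<omega>. Z \<omega> * poly g' (X s \<omega>) \<partial>M)" by blast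
  show "\<exists>g. \<forall>Z. ess_bounded M (sigma_gen M X {0..s}) Z \<longrightarrow>
    (\<integral>\<omega>. Z \<omega> * poly (f + f') (X t \<omega>) \<partial>M) = (\<integral>\<omega>. Z \<omega> * poly g (X s \<omega>) \<partial>M)"
    using g g' ints by (intro exI[of _ "g + g'"]) (simp add: distrib_left)
qed

text \<open>The Markov property for monomials in several future variables, by conditioning
  successively from the latest time down to \<open>u\<close>.\<close>

lemma future_poly_conditional_poly:
  assumes "finite J" "0 \<le> u" "\<And>j. j \<in> J \<Longrightarrow> u \<le> j"
  shows "\<exists>g. \<forall>Z. ess_bounded M (sigma_gen M X {0..u}) Z \<longrightarrow>
    (\<integral>\<omega>. Z \<omega> * (\<Prod>j\<in>J. X j \<omega> ^ n j) \<partial>M) = (\<integral>\<omega>. Z \<omega> * poly g (X u \<omega>) \<partial>M)"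
  using assms
proof (induction J arbitrary: u rule: finite_linorder_min_induct)
  case empty
  show ?case by (rule exI[of _ 1]) simp
next
  case (insert m J)
  have um: "u \<le> m" "0 \<le> m" using insert.prems by force+
  obtain g where g: "\<And>Z. ess_bounded M (sigma_gen M X {0..m}) Z \<Longrightarrow>
      (\<integral>\<omega>. Z \<omega> * (\<Prod>j\<in>J. X j \<omega> ^ n j) \<partial>M) = (\<integral>\<omega>. Z \<omega> * poly g (X m \<omega>) \<partial>M)"
    using insert.IH[of m] insert.hyps um by force
  obtain h where h: "\<And>Z. ess_bounded M (sigma_gen M X {0..u}) Z \<Longrightarrow>
      (\<integral>\<omega>. Z \<omega> * poly ([:0, 1:] ^ n m * g) (X m \<omega>) \<partial>M) = (\<integral>\<omega>. Z \<omega> * poly h (X u \<omega>) \<partial>M)"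
    using poly_conditional_poly[OF insert.prems(1) um(1)] by blast
  have "(\<integral>\<omega>. Z \<omega> * (\<Prod>j\<in>insert m J. X j \<omega> ^ n j) \<partial>M) = (\<integral>\<omega>. Z \<omega> * poly h (X u \<omega>) \<partial>M)"
    if Z: "ess_bounded M (sigma_gen M X {0..u}) Z" for Z
  proof -
    have "m \<notin> J" using insert.hyps by auto
    then have "(\<integral>\<omega>. Z \<omega> * (\<Prod>j\<in>insert m J. X j \<omega> ^ n j) \<partial>M)
        = (\<integral>\<omega>. (Z \<omega> * X m \<omega> ^ n m) * (\<Prod>j\<in>J. X j \<omega> ^ n j) \<partial>M)"
      using insert.hyps by (simp add: mult.assoc)
    also have "\<dots> = (\<integral>\<omega>. (Z \<omega> * X m \<omega> ^ n m) * poly g (X m \<omega>) \<partial>M)"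
      using um by (intro g ess_bounded_mult past_mono[OF _ Z] ess_bounded_power past_ess_bounded) auto
    also have "\<dots> = (\<integral>\<omega>. Z \<omega> * poly h (X u \<omega>) \<partial>M)"
      using h[OF Z] by (simp add: mult.assoc)
    finally show ?thesis .
  qed
  then show ?case by blast
qed

text \<open>A monomial in the variables that generate \<open>\<G>\<^sub>s\<^sub>,\<^sub>u\<close> splits into a bounded function \<open>Z\<close> of the past of \<open>s\<close>
  and a monomial in the future of \<open>u\<close>. As \<open>Y\<close> and \<open>L\<close> are known at time \<open>u\<close>, the latter may be
  replaced by a polynomial in \<open>X\<^sub>u\<close>, and these are spanned by the \<open>p\<^sub>n\<close>.\<close>

lemma cond_exp_eqI:
  assumes su: "0 \<le> s" "s < u" and Y: "ess_bounded M (sigma_gen M X {0..u}) Y"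
    and L: "ess_bounded M (sigma_gen M X {s, u}) L"
    and test: "\<And>Z n. ess_bounded M (sigma_gen M X {0..s}) Z \<Longrightarrow>
      (\<integral>\<omega>. Z \<omega> * Y \<omega> * poly (p u n) (X u \<omega>) \<partial>M) = (\<integral>\<omega>. Z \<omega> * L \<omega> * poly (p u n) (X u \<omega>) \<partial>M)"
  shows "AE \<omega> in M. real_cond_exp M (sigma_gen M X ({0..s} \<union> {u..})) Y \<omega> = L \<omega>"
proof -
  let ?G = "sigma_gen M X ({0..s} \<union> {u..})"
  interpret G: finite_measure_subalgebra M ?G
    by unfold_locales (rule subalgebra_gen, use su in auto)
  have Lu: "ess_bounded M (sigma_gen M X {0..u}) L"
    by (rule ess_bounded_sigma_gen_mono[OF _ L]) (use su in auto)
  have LG: "ess_bounded M ?G L"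
    by (rule ess_bounded_sigma_gen_mono[OF _ L]) (use su in auto)
  have Du: "ess_bounded M (sigma_gen M X {0..u}) (\<lambda>\<omega>. Y \<omega> - L \<omega>)"
    using Y Lu by (rule ess_bounded_diff)
  note YM = past_ess_bounded_M[OF Y] and LM = past_ess_bounded_M[OF Lu]
    and DM = past_ess_bounded_M[OF Du]
  have poly_test: "(\<integral>\<omega>. (Z \<omega> * (Y \<omega> - L \<omega>)) * poly f (X u \<omega>) \<partial>M) = 0"
    if Z: "ess_bounded M (sigma_gen M X {0..s}) Z" for Z f
  proof (rule three_term_span[OF three_term_mart_poly[of \<theta> u \<eta>]])
    note ZM = past_ess_bounded_M[OF Z]
    have int: "integrable M (\<lambda>\<omega>. (Z \<omega> * V \<omega>) * poly f (X u \<omega>))"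
      if "ess_bounded M M V" for V f
      using su by (intro ess_bounded_integrable ess_bounded_mult ess_bounded_poly X_bounded ZM that) simp
    show "(\<integral>\<omega>. (Z \<omega> * (Y \<omega> - L \<omega>)) * poly (p u n) (X u \<omega>) \<partial>M) = 0" for n
      using test[OF Z] int[OF YM] int[OF LM] by (simp add: right_diff_distrib left_diff_distrib)
    show "(\<integral>\<omega>. (Z \<omega> * (Y \<omega> - L \<omega>)) * poly (f + g) (X u \<omega>) \<partial>M) = 0"
      if "(\<integral>\<omega>. (Z \<omega> * (Y \<omega> - L \<omega>)) * poly f (X u \<omega>) \<partial>M) = 0"
        "(\<integral>\<omega>. (Z \<omega> * (Y \<omega> - L \<omega>)) * poly g (X u \<omega>) \<partial>M) = 0" for f g
      using that int[OF DM] by (simp add: distrib_left)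
    show "(\<integral>\<omega>. (Z \<omega> * (Y \<omega> - L \<omega>)) * poly (smult c f) (X u \<omega>) \<partial>M) = 0"
      if "(\<integral>\<omega>. (Z \<omega> * (Y \<omega> - L \<omega>)) * poly f (X u \<omega>) \<partial>M) = 0" for c f
      using that by (simp add: mult.left_commute[of _ c])
  qed
  have moments: "(\<integral>\<omega>. (Y \<omega> - L \<omega>) * (\<Prod>j\<in>J. X j \<omega> ^ n j) \<partial>M) = 0"
    if J: "finite J" "J \<subseteq> {0..s} \<union> {u..}" for J n
  proof -
    define Z where "Z \<omega> = (\<Prod>j\<in>J \<inter> {0..s}. X j \<omega> ^ n j)" for \<omega>
    have Z: "ess_bounded M (sigma_gen M X {0..s}) Z"
      unfolding Z_def by (intro ess_bounded_prod ess_bounded_power past_ess_bounded) auto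
    have Zu: "ess_bounded M (sigma_gen M X {0..u}) Z"
      using su by (intro past_mono[OF _ Z]) simp
    obtain g where g: "\<And>Z. ess_bounded M (sigma_gen M X {0..u}) Z \<Longrightarrow>
        (\<integral>\<omega>. Z \<omega> * (\<Prod>j\<in>J \<inter> {u..}. X j \<omega> ^ n j) \<partial>M) = (\<integral>\<omega>. Z \<omega> * poly g (X u \<omega>) \<partial>M)"
      using future_poly_conditional_poly[of "J \<inter> {u..}" u n] J su by auto
    have "J = (J \<inter> {0..s}) \<union> (J \<inter> {u..})" using J by auto
    then have "(\<Prod>j\<in>J. X j \<omega> ^ n j) = Z \<omega> * (\<Prod>j\<in>J \<inter> {u..}. X j \<omega> ^ n j)" for \<omega>
      unfolding Z_def using J su
      by (subst prod.union_disjoint[symmetric]) (auto intro: prod.cong)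
    then have "(\<integral>\<omega>. (Y \<omega> - L \<omega>) * (\<Prod>j\<in>J. X j \<omega> ^ n j) \<partial>M)
        = (\<integral>\<omega>. (Z \<omega> * (Y \<omega> - L \<omega>)) * (\<Prod>j\<in>J \<inter> {u..}. X j \<omega> ^ n j) \<partial>M)"
      by (simp add: ac_simps)
    also have "\<dots> = (\<integral>\<omega>. (Z \<omega> * (Y \<omega> - L \<omega>)) * poly g (X u \<omega>) \<partial>M)"
      by (intro g ess_bounded_mult Zu Du)
    also have "\<dots> = 0" by (rule poly_test[OF Z])
    finally show ?thesis .
  qed
  show ?thesis
  proof (rule G.real_cond_exp_charact)
    fix A assume A: "A \<in> sets ?G"
    have "(\<integral>\<omega>. (Y \<omega> - L \<omega>) * indicator A \<omega> \<partial>M) = 0"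
      by (rule joint_moments_zero_imp_sigma_zero[OF ess_bounded_integrable[OF DM] _ moments A])
        (use su in \<open>auto intro!: X_bounded\<close>)
    moreover have "A \<in> sets M" using A G.subalg unfolding subalgebra_def by blast
    then have "integrable M (\<lambda>\<omega>. Y \<omega> * indicator A \<omega>)" "integrable M (\<lambda>\<omega>. L \<omega> * indicator A \<omega>)"
      using ess_bounded_integrable[OF YM] ess_bounded_integrable[OF LM]
      by (auto intro!: integrable_real_mult_indicator)
    ultimately show "(\<integral>\<omega>\<in>A. Y \<omega> \<partial>M) = (\<integral>\<omega>\<in>A. L \<omega> \<partial>M)"
      by (simp add: set_lebesgue_integral_def left_diff_distrib mult.commute[of "indicator A _"])
  next
    show "integrable M Y" "integrable M L" by (intro ess_bounded_integrable YM LM)+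
    show "L \<in> borel_measurable ?G" using LG unfolding ess_bounded_def by simp
  qed
qed

lemma integral_mult_mart_poly:
  assumes Z: "ess_bounded M M Z" and r: "0 \<le> r"
  shows "(\<integral>\<omega>. (Z \<omega> * X r \<omega>) * poly (p r n) (X r \<omega>) \<partial>M)
    = jacobi \<eta> \<theta> r (\<lambda>k. \<integral>\<omega>. Z \<omega> * poly (p r k) (X r \<omega>) \<partial>M) n"
proof -
  have int: "integrable M (\<lambda>\<omega>. Z \<omega> * poly (p r k) (X r \<omega>))" for k
    by (intro ess_bounded_integrable ess_bounded_mult Z ess_bounded_poly X_bounded r)
  have "(\<integral>\<omega>. (Z \<omega> * X r \<omega>) * poly (p r n) (X r \<omega>) \<partial>M)
    = (\<integral>\<omega>. jacobi \<eta> \<theta> r (\<lambda>k. Z \<omega> * poly (p r k) (X r \<omega>)) n \<partial>M)"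
  proof (rule Bochner_Integration.integral_cong[OF refl])
    fix \<omega>
    have "(Z \<omega> * X r \<omega>) * poly (p r n) (X r \<omega>)
        = Z \<omega> * jacobi \<eta> \<theta> r (\<lambda>k. poly (p r k) (X r \<omega>)) n"
      unfolding poly_mart_poly_jacobi[symmetric] by simp
    also have "\<dots> = jacobi \<eta> \<theta> r (\<lambda>k. Z \<omega> * poly (p r k) (X r \<omega>)) n"
      unfolding jacobi_def by (cases n) (simp_all add: algebra_simps)
    finally show "(Z \<omega> * X r \<omega>) * poly (p r n) (X r \<omega>)
        = jacobi \<eta> \<theta> r (\<lambda>k. Z \<omega> * poly (p r k) (X r \<omega>)) n" .
  qed
  also have "\<dots> = jacobi \<eta> \<theta> r (\<lambda>k. \<integral>\<omega>. Z \<omega> * poly (p r k) (X r \<omega>) \<partial>M) n"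
    unfolding jacobi_def using int by (cases n) (simp_all del: mart_poly.simps)
  finally show ?thesis .
qed

text \<open>The martingale property is used twice: it moves \<open>p\<^sub>n\<close> from time \<open>u\<close> to time \<open>r\<close>, where
  multiplication by \<open>X\<^sub>r\<close> is the operator \<open>A + rG\<close>, and then on to time \<open>s\<close>.\<close>

lemma first_moment_jacobi:
  assumes "0 \<le> s" "s \<le> r" "r \<le> u" and Z: "ess_bounded M (sigma_gen M X {0..s}) Z"
  shows "(\<integral>\<omega>. Z \<omega> * X r \<omega> * poly (p u n) (X u \<omega>) \<partial>M)
    = jacobi \<eta> \<theta> r (\<lambda>k. \<integral>\<omega>. Z \<omega> * poly (p s k) (X s \<omega>) \<partial>M) n"
proof -
  have "(\<integral>\<omega>. (Z \<omega> * X r \<omega>) * poly (p u n) (X u \<omega>) \<partial>M)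
      = (\<integral>\<omega>. (Z \<omega> * X r \<omega>) * poly (p r n) (X r \<omega>) \<partial>M)"
    using assms by (intro mart_poly_martingale ess_bounded_mult past_mono[OF _ Z] past_ess_bounded) auto
  also have "\<dots> = jacobi \<eta> \<theta> r (\<lambda>k. \<integral>\<omega>. Z \<omega> * poly (p r k) (X r \<omega>) \<partial>M) n"
    using assms by (intro integral_mult_mart_poly past_ess_bounded_M[OF Z]) auto
  also have "\<dots> = jacobi \<eta> \<theta> r (\<lambda>k. \<integral>\<omega>. Z \<omega> * poly (p s k) (X s \<omega>) \<partial>M) n"
    using mart_poly_martingale[OF assms(1,2) Z] by simp
  finally show ?thesis .
qed

text \<open>The previous lemma at time \<open>r'\<close> with \<open>Z X\<^sub>r\<close>, known at time \<open>r\<close>, in place of \<open>Z\<close>, then at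
  time \<open>r\<close>; the later time gives the outer operator.\<close>

lemma second_moment_jacobi:
  assumes "0 \<le> s" "s \<le> r" "r \<le> r'" "r' \<le> u" and Z: "ess_bounded M (sigma_gen M X {0..s}) Z"
  shows "(\<integral>\<omega>. Z \<omega> * X r \<omega> * X r' \<omega> * poly (p u n) (X u \<omega>) \<partial>M)
    = jacobi \<eta> \<theta> r' (jacobi \<eta> \<theta> r (\<lambda>k. \<integral>\<omega>. Z \<omega> * poly (p s k) (X s \<omega>) \<partial>M)) n"
proof -
  have ZX: "ess_bounded M (sigma_gen M X {0..r}) (\<lambda>\<omega>. Z \<omega> * X r \<omega>)"
    using assms by (intro ess_bounded_mult past_mono[OF _ Z] past_ess_bounded) auto
  have "(\<integral>\<omega>. Z \<omega> * X r \<omega> * X r' \<omega> * poly (p u n) (X u \<omega>) \<partial>M)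
      = jacobi \<eta> \<theta> r' (\<lambda>k. \<integral>\<omega>. Z \<omega> * X r \<omega> * poly (p r k) (X r \<omega>) \<partial>M) n"
    using assms by (intro first_moment_jacobi[OF _ _ _ ZX]) auto
  also have "(\<lambda>k. \<integral>\<omega>. Z \<omega> * X r \<omega> * poly (p r k) (X r \<omega>) \<partial>M)
      = jacobi \<eta> \<theta> r (\<lambda>k. \<integral>\<omega>. Z \<omega> * poly (p s k) (X s \<omega>) \<partial>M)"
    using assms by (intro ext first_moment_jacobi) auto
  finally show ?thesis .
qed

text \<open>The polynomials \<open>p\<^sub>1\<close> and \<open>p\<^sub>2\<close> have the constant means \<open>p\<^sub>1(0; 0) = - \<theta>\<close> and \<open>p\<^sub>2(0; 0) = \<theta>\<^sup>2\<close>.\<close>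

lemma expectation_X:
  assumes "0 \<le> t"
  shows "(\<integral>\<omega>. X t \<omega> \<partial>M) = 0"
    and "(\<integral>\<omega>. X t \<omega> ^ 2 \<partial>M) = t"
proof -
  have b: "ess_bounded M M (X t)" using X_bounded assms .
  note [simp] = ess_bounded_integrable[OF b] ess_bounded_integrable[OF ess_bounded_power[OF b, of 2]]
  have mart: "(\<integral>\<omega>. poly (p t n) (X t \<omega>) \<partial>M) = poly (p 0 n) 0" for n
  proof -
    have "(\<integral>\<omega>. poly (p t n) (X t \<omega>) \<partial>M) = (\<integral>\<omega>. poly (p 0 n) (X 0 \<omega>) \<partial>M)"
      using mart_poly_martingale[OF order_refl assms, of "\<lambda>_. 1" n] by simp
    also have "\<dots> = (\<integral>\<omega>. poly (p 0 n) 0 \<partial>M)"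
    proof (rule integral_cong_AE)
      show "(\<lambda>\<omega>. poly (p 0 n) (X 0 \<omega>)) \<in> borel_measurable M"
        using ess_bounded_poly[OF X_bounded[OF order_refl]] unfolding ess_bounded_def by blast
      show "AE \<omega> in M. poly (p 0 n) (X 0 \<omega>) = poly (p 0 n) 0"
        using start by eventually_elim simp
    qed simp
    finally show ?thesis by (simp add: prob_space)
  qed
  show E1: "(\<integral>\<omega>. X t \<omega> \<partial>M) = 0"
    using mart[of "Suc 0"] by (simp add: prob_space)
  have "poly (p t (Suc (Suc 0))) y = y ^ 2 - (2 * \<theta> + t * \<eta>) * y + (\<theta>\<^sup>2 - t)" for y
    by (simp add: power2_eq_square algebra_simps)
  then have "(\<integral>\<omega>. X t \<omega> ^ 2 \<partial>M) + (\<theta>\<^sup>2 - t) = poly (p 0 (Suc (Suc 0))) 0"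
    using mart[of "Suc (Suc 0)"] E1 by (simp add: prob_space del: mart_poly.simps)
  then show "(\<integral>\<omega>. X t \<omega> ^ 2 \<partial>M) = t" by (simp add: power2_eq_square)
qed

lemma covariance_X:
  assumes "0 \<le> s" "s \<le> t"
  shows "(\<integral>\<omega>. X s \<omega> * X t \<omega> \<partial>M) = s"
proof -
  have b: "ess_bounded M M (X s)" "ess_bounded M M (X t)" using X_bounded assms by auto
  note [simp] = ess_bounded_integrable[OF ess_bounded_mult[OF b]]
    ess_bounded_integrable[OF b(1)] ess_bounded_integrable[OF ess_bounded_power[OF b(1), of 2]]
  have "(\<integral>\<omega>. X s \<omega> * poly (p t (Suc 0)) (X t \<omega>) \<partial>M) = (\<integral>\<omega>. X s \<omega> * poly (p s (Suc 0)) (X s \<omega>) \<partial>M)"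
    by (rule mart_poly_martingale[OF assms past_ess_bounded]) (use assms in auto)
  then have "(\<integral>\<omega>. X s \<omega> * X t \<omega> - \<theta> * X s \<omega> \<partial>M) = (\<integral>\<omega>. X s \<omega> ^ 2 - \<theta> * X s \<omega> \<partial>M)"
    by (simp add: algebra_simps power2_eq_square)
  then show ?thesis using expectation_X[OF assms(1)] by simp
qed

section \<open>Conditional mean and conditional variance\<close>

lemma endpoint_ess_bounded:
  "0 \<le> s \<Longrightarrow> s < u \<Longrightarrow> r \<in> {s, u} \<Longrightarrow> ess_bounded M (sigma_gen M X {s, u}) (X r)"
  using X_bounded[of r] measurable_sigma_gen[of r "{s, u}" X M] unfolding ess_bounded_def by auto

lemma conditional_mean:
  assumes "0 \<le> s" "s < t" "t < u"
  shows "AE \<omega> in M. real_cond_exp M (sigma_gen M X ({0..s} \<union> {u..})) (X t) \<omega>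
    = (u - t) / (u - s) * X s \<omega> + (t - s) / (u - s) * X u \<omega>"
proof (rule cond_exp_eqI)
  show "ess_bounded M (sigma_gen M X {s, u})
      (\<lambda>\<omega>. (u - t) / (u - s) * X s \<omega> + (t - s) / (u - s) * X u \<omega>)"
    using assms
    by (intro ess_bounded_add ess_bounded_mult ess_bounded_const endpoint_ess_bounded) auto
  fix Z n assume Z: "ess_bounded M (sigma_gen M X {0..s}) Z"
  define \<alpha> where "\<alpha> k = (\<integral>\<omega>. Z \<omega> * poly (p s k) (X s \<omega>) \<partial>M)" for k
  have int: "integrable M (\<lambda>\<omega>. Z \<omega> * X r \<omega> * poly (p u n) (X u \<omega>))" if "0 \<le> r" for r
    using assms that by (intro ess_bounded_integrable ess_bounded_mult ess_bounded_poly X_bounded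
      past_ess_bounded_M[OF Z]) auto
  have mom: "(\<integral>\<omega>. Z \<omega> * X r \<omega> * poly (p u n) (X u \<omega>) \<partial>M) = jacobi \<eta> \<theta> r \<alpha> n"
    if "s \<le> r" "r \<le> u" for r
    unfolding \<alpha>_def using first_moment_jacobi[OF assms(1) that Z] .
  have "(\<integral>\<omega>. Z \<omega> * ((u - t) / (u - s) * X s \<omega> + (t - s) / (u - s) * X u \<omega>) * poly (p u n) (X u \<omega>) \<partial>M)
      = (\<integral>\<omega>. (u - t) / (u - s) * (Z \<omega> * X s \<omega> * poly (p u n) (X u \<omega>))
          + (t - s) / (u - s) * (Z \<omega> * X u \<omega> * poly (p u n) (X u \<omega>)) \<partial>M)"
    by (simp add: algebra_simps)
  also have "\<dots> = (u - t) / (u - s) * jacobi \<eta> \<theta> s \<alpha> n + (t - s) / (u - s) * jacobi \<eta> \<theta> u \<alpha> n"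
    using assms int[of s] int[of u] by (simp add: mom)
  also have "\<dots> = jacobi \<eta> \<theta> t \<alpha> n"
    using assms by (intro jacobi_interpolation[symmetric]) simp
  finally show "(\<integral>\<omega>. Z \<omega> * X t \<omega> * poly (p u n) (X u \<omega>) \<partial>M)
      = (\<integral>\<omega>. Z \<omega> * ((u - t) / (u - s) * X s \<omega> + (t - s) / (u - s) * X u \<omega>) * poly (p u n) (X u \<omega>) \<partial>M)"
    using mom[of t] assms by simp
qed (use assms past_ess_bounded in auto)

lemma conditional_second_moment:
  assumes "0 \<le> s" "s < t" "t < u" and \<kappa>: "\<kappa> = (u - t) * (t - s) / u"
  shows "AE \<omega> in M. real_cond_exp M (sigma_gen M X ({0..s} \<union> {u..})) (\<lambda>\<omega>. (X t \<omega>)\<^sup>2) \<omega>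
    = (u - t) / (u - s) * (X s \<omega> * X s \<omega>)
      + (2 * (u - t) * (t - s) - \<kappa> * (s + u)) / (u - s)\<^sup>2 * (X s \<omega> * X u \<omega>)
      + ((t - s)\<^sup>2 + \<kappa> * s) / (u - s)\<^sup>2 * (X u \<omega> * X u \<omega>)
      + \<kappa> * (\<eta> * u - \<theta>) / (u - s) * X s \<omega>
      + \<kappa> * (\<theta> - \<eta> * s) / (u - s) * X u \<omega>
      + \<kappa>"
    (is "AE \<omega> in M. _ = ?a * _ + ?b * _ + ?c * _ + ?d * _ + ?e * _ + _")
proof (rule cond_exp_eqI)
  show "ess_bounded M (sigma_gen M X {s, u}) (\<lambda>\<omega>. ?a * (X s \<omega> * X s \<omega>)
      + ?b * (X s \<omega> * X u \<omega>) + ?c * (X u \<omega> * X u \<omega>) + ?d * X s \<omega> + ?e * X u \<omega> + \<kappa>)"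
    using assms
    by (intro ess_bounded_add ess_bounded_mult ess_bounded_const endpoint_ess_bounded) auto
  show "ess_bounded M (sigma_gen M X {0..u}) (\<lambda>\<omega>. (X t \<omega>)\<^sup>2)"
    using assms by (intro ess_bounded_power past_ess_bounded) auto
  fix Z n assume Z: "ess_bounded M (sigma_gen M X {0..s}) Z"
  define \<alpha> where "\<alpha> k = (\<integral>\<omega>. Z \<omega> * poly (p s k) (X s \<omega>) \<partial>M)" for k
  \<comment> \<open>the test functional; linear in \<open>f\<close>\<close>
  define I where "I f = (\<integral>\<omega>. Z \<omega> * f \<omega> * poly (p u n) (X u \<omega>) \<partial>M)" for f
  have int: "integrable M (\<lambda>\<omega>. Z \<omega> * f \<omega> * poly (p u n) (X u \<omega>))" if "ess_bounded M M f" for f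
    using assms that by (intro ess_bounded_integrable ess_bounded_mult ess_bounded_poly X_bounded
      past_ess_bounded_M[OF Z]) auto
  have I_add: "I (\<lambda>\<omega>. f \<omega> + g \<omega>) = I f + I g" if "ess_bounded M M f" "ess_bounded M M g" for f g
    unfolding I_def using int[OF that(1)] int[OF that(2)] by (simp add: distrib_left distrib_right)
  have I_cmult: "I (\<lambda>\<omega>. k * f \<omega>) = k * I f" for k f
    unfolding I_def by (simp add: mult.left_commute[of _ k] mult.assoc)
  have I0: "I (\<lambda>\<omega>. \<kappa>) = \<kappa> * \<alpha> n"
    using I_cmult[of \<kappa> "\<lambda>_. 1"] mart_poly_martingale[OF assms(1) _ Z, of u n] assms
    by (simp add: I_def \<alpha>_def)
  have I1: "I (X r) = jacobi \<eta> \<theta> r \<alpha> n" if "s \<le> r" "r \<le> u" for r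
    unfolding \<alpha>_def I_def using first_moment_jacobi[OF assms(1) that Z] .
  have I2: "I (\<lambda>\<omega>. X r \<omega> * X r' \<omega>) = jacobi \<eta> \<theta> r' (jacobi \<eta> \<theta> r \<alpha>) n"
    if "s \<le> r" "r \<le> r'" "r' \<le> u" for r r'
    unfolding \<alpha>_def I_def using second_moment_jacobi[OF assms(1) that Z] by (simp add: mult.assoc)
  have b: "ess_bounded M M (X s)" "ess_bounded M M (X u)" using X_bounded assms by auto
  have "I (\<lambda>\<omega>. ?a * (X s \<omega> * X s \<omega>) + ?b * (X s \<omega> * X u \<omega>) + ?c * (X u \<omega> * X u \<omega>)
        + ?d * X s \<omega> + ?e * X u \<omega> + \<kappa>)
      = ?a * I (\<lambda>\<omega>. X s \<omega> * X s \<omega>) + ?b * I (\<lambda>\<omega>. X s \<omega> * X u \<omega>) + ?c * I (\<lambda>\<omega>. X u \<omega> * X u \<omega>)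
        + ?d * I (X s) + ?e * I (X u) + I (\<lambda>_. \<kappa>)"
    using b
    by (simp only: I_add I_cmult ess_bounded_add ess_bounded_mult ess_bounded_const)
  also have "\<dots> = jacobi \<eta> \<theta> t (jacobi \<eta> \<theta> t \<alpha>) n"
    unfolding jacobi_quadratic[OF assms(1) less_trans[OF assms(2,3)] \<kappa>] I0
    using assms(1-3) by (simp add: I1 I2)
  also have "\<dots> = I (\<lambda>\<omega>. (X t \<omega>)\<^sup>2)"
    using I2[of t t] assms by (simp add: power2_eq_square)
  finally show "(\<integral>\<omega>. Z \<omega> * (X t \<omega>)\<^sup>2 * poly (p u n) (X u \<omega>) \<partial>M)
      = (\<integral>\<omega>. Z \<omega> * (?a * (X s \<omega> * X s \<omega>) + ?b * (X s \<omega> * X u \<omega>) + ?c * (X u \<omega> * X u \<omega>)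
        + ?d * X s \<omega> + ?e * X u \<omega> + \<kappa>) * poly (p u n) (X u \<omega>) \<partial>M)"
    unfolding I_def by (rule sym)
qed (use assms in auto)

lemma conditional_variance:
  assumes "0 \<le> s" "s < t" "t < u"
  shows "AE \<omega> in M. cond_variance M (sigma_gen M X ({0..s} \<union> {u..})) (X t) \<omega>
    = (u - t) * (t - s) / u *
      (1 + \<eta> * ((u * X s \<omega> - s * X u \<omega>) / (u - s))
         + \<theta> * ((X u \<omega> - X s \<omega>) / (u - s))
         + (X u \<omega> - X s \<omega>) * (s * X u \<omega> - u * X s \<omega>) / (u - s)\<^sup>2)"
  using conditional_mean[OF assms] conditional_second_moment[OF assms refl]
proof eventually_elim
  case (elim \<omega>)
  show ?case
    unfolding cond_variance_def elim
    by (rule harness_variance_expand[OF assms(1) less_trans[OF assms(2,3)] refl])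
qed

end

theorem theorem2p5:
  fixes \<eta> \<theta> :: real
    and P :: "real \<Rightarrow> real \<Rightarrow> real \<Rightarrow> real measure"
    and M :: "'a measure"
    and X :: "real \<Rightarrow> 'a \<Rightarrow> real"
  assumes "1 + \<eta> * \<theta> \<ge> 0"
    and "transition_kernels \<eta> \<theta> P"
    and "prob_space M"
    and "markov_process M (state_space \<eta>) P X"
    and "AE \<omega> in M. X 0 \<omega> = 0"
  shows "(\<forall>t\<ge>0. integrable M (X t) \<and> (\<integral>\<omega>. X t \<omega> \<partial>M) = 0) \<and>
         (\<forall>s\<ge>0. \<forall>t\<ge>0. integrable M (\<lambda>\<omega>. X t \<omega> * X s \<omega>) \<and>
                         (\<integral>\<omega>. X t \<omega> * X s \<omega> \<partial>M) = min t s) \<and>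
         (\<forall>s t u. 0 \<le> s \<and> s < t \<and> t < u \<longrightarrow>
            (AE \<omega> in M. real_cond_exp M (sigma_gen M X ({0..s} \<union> {u..})) (X t) \<omega>
               = (u - t) / (u - s) * X s \<omega> + (t - s) / (u - s) * X u \<omega>)) \<and>
         (\<forall>s t u. 0 \<le> s \<and> s < t \<and> t < u \<longrightarrow>
            (AE \<omega> in M. cond_variance M (sigma_gen M X ({0..s} \<union> {u..})) (X t) \<omega>
               = (u - t) * (t - s) / u *
                 (1 + \<eta> * ((u * X s \<omega> - s * X u \<omega>) / (u - s))
                    + \<theta> * ((X u \<omega> - X s \<omega>) / (u - s))
                    + (X u \<omega> - X s \<omega>) * (s * X u \<omega> - u * X s \<omega>) / (u - s)\<^sup>2)))"
proof -
  interpret prob_space M by (rule assms)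
  interpret free_bi_poisson M \<eta> \<theta> P X by unfold_locales (rule assms)+
  have "(\<integral>\<omega>. X t \<omega> * X s \<omega> \<partial>M) = min t s" if "0 \<le> s" "0 \<le> t" for s t
  proof (cases "s \<le> t")
    case True
    then show ?thesis using covariance_X[of s t] that by (simp add: mult.commute)
  next
    case False
    then show ?thesis using covariance_X[of t s] that by simp
  qed
  then show ?thesis
    using expectation_X(1) conditional_mean conditional_variance
    by (intro conjI allI impI ess_bounded_integrable ess_bounded_mult X_bounded) auto
qed

end
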